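(* Let $d\in\mathbb{N}$ with $d\geq 2$, let $(c_{n})_{n\in\mathbb{N}}$ be a sequence of real numbers with $c_{n}\geq\left(1+\frac{2^{d+7}}{\log n}\right)^{1/d}$ for every $n\geq 2$, and let $q\in\mathbb{R}$ with $q\geq 1$ and $q>3/d$. For each $n\in\mathbb{N}$ define $F_{n}\colon \binom{\mathbb{Z}^{d}}{n^{d}}\to(0,\infty)$ by $$F_{n}(S)=\min\{\operatorname{Lip}(f)\colon f\colon S\to\{1,\ldots,n\}^{d}\text{ surjective}\}.$$ Consider the probability space $\mathcal{G}_{(c_{n})}=\prod_{n=1}^{\infty}\binom{\{1,\ldots,\lfloor c_{n} n\rfloor\}^{d}}{n^{d}}$ equipped with the product of the uniform probability measures on its finite factors. Then a random sequence $(S_{n})\in\mathcal{G}_{(c_{n})}$ satisfies $$\mathbb{P}\left[\limsup_{n\to\infty}F_{n}(S_{n})(\log n)^{-q}<\infty\right]=1.$$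
   Context: $\log$ denotes the logarithm to base $2$. For a set $A$ and $k\in\mathbb{N}$, $\binom{A}{k}$ is the set of all $k$-element subsets of $A$. Lipschitz constants are taken with respect to the Euclidean metric. For a finite set $X$ the uniform probability measure is $\mathbb{P}_X(A)=|A|/|X|$ for $A\subseteq X$; on a countable product of finite sets one takes the product of these uniform measures. *)

theory Defs
  imports "HOL-Probability.Probability"
begin

definition grid :: "nat \<Rightarrow> int \<Rightarrow> int list set" where
  "grid d m = {x. length x = d \<and> (\<forall>i\<in>set x. 1 \<le> i \<and> i \<le> m)}"

definition edist :: "int list \<Rightarrow> int list \<Rightarrow> real" where
  "edist x y = sqrt (\<Sum>i<length x. (real_of_int (x ! i - y ! i))^2)"

definition lip :: "int list set \<Rightarrow> (int list \<Rightarrow> int list) \<Rightarrow> real" where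
  "lip S f = Inf {L. 0 \<le> L \<and> (\<forall>x\<in>S. \<forall>y\<in>S. edist (f x) (f y) \<le> L * edist x y)}"

definition F :: "nat \<Rightarrow> nat \<Rightarrow> int list set \<Rightarrow> real" where
  "F d n S = Min {lip S f | f. (\<forall>x\<in>S. f x \<in> grid d (int n)) \<and> f ` S = grid d (int n)}"

definition factor :: "nat \<Rightarrow> (nat \<Rightarrow> real) \<Rightarrow> nat \<Rightarrow> int list set set" where
  "factor d c n = {S. S \<subseteq> grid d \<lfloor>c n * real n\<rfloor> \<and> card S = n ^ d}"

text \<open>The product probability space G_(c_n) (index 0 gives the trivial factor {{}}).\<close>
definition G :: "nat \<Rightarrow> (nat \<Rightarrow> real) \<Rightarrow> (nat \<Rightarrow> int list set) measure" where
  "G d c = PiM UNIV (\<lambda>n. uniform_count_measure (factor d c n))"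

end

theory Submission
  imports Defs
begin

text \<open>
  Put \<open>L = log 2 n\<close> and \<open>N = \<lfloor>c n * n\<rfloor> \<ge> n\<close>, and let \<open>g\<close> be the scaling by \<open>n / N\<close>
  from the large cube onto the cells \<open>{1..n}\<close> to the power \<open>d\<close>, rounded up. Distinct lattice points
  have distance at least \<open>1\<close>, so a bijection \<open>f\<close> from \<open>S\<close> to the small cube with
  \<open>f\<close> within \<open>D\<close> of \<open>g\<close> in every coordinate has Lipschitz constant \<open>O(D)\<close>.
  By a Chernoff bound for uniformly random subsets of fixed size, with probability \<open>1 - O(1 / n^2)\<close> every box
  of \<open>m\<close> cells contains \<open>m + O(m^(1-1/d)) + O(sqrt (L m))\<close> points of \<open>S\<close>.
  Given this, split the target cube repeatedly in half along its longest side, and split the points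
  along the same coordinate in the same proportion. If the current box has side \<open>u\<close>, the cutting
  hyperplanes drift apart by \<open>O(1 + sqrt (L u^(2-d)))\<close> per split. Stopping at side length
  \<open>s = K L^q\<close>, after \<open>O(L)\<close> splits, the total drift is \<open>O(L + sqrt (L^3 s^(2-d)))\<close>, which is at most
  a small multiple of \<open>s\<close> because \<open>q \<ge> 1\<close> and \<open>q \<ge> 3 / d\<close>. Any bijection inside the final boxes will do,
  so \<open>D = O(s)\<close>. Borel--Cantelli concludes.
\<close>

subsection \<open>A Chernoff bound for random subsets of fixed size\<close>

text \<open>The quotient of the two binomial coefficients is the product of
  \<open>(k - i) / (M - i)\<close> over \<open>i < t\<close>, and no factor exceeds
  \<open>k / M\<close>. The induction removes one factor at a time.\<close>

lemma binomial_ratio_le: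
  assumes "t \<le> k" "k \<le> M"
  shows "real ((M - t) choose (k - t)) \<le> (real k / real M) ^ t * real (M choose k)"
  using assms
proof (induction t arbitrary: k M)
  case 0
  then show ?case by simp
next
  case (Suc t)
  then obtain k' M' where km: "k = Suc k'" "M = Suc M'" "t \<le> k'" "k' \<le> M'"
    by (metis Suc_le_D Suc_le_mono le_trans)
  have "real ((M - Suc t) choose (k - Suc t)) \<le> (real k' / real M') ^ t * real (M' choose k')"
    using Suc.IH[of k' M'] km by simp
  also have "\<dots> \<le> (real k / real M) ^ t * real (M' choose k')"
  proof (intro mult_right_mono power_mono)
    show "real k' / real M' \<le> real k / real M"
      using km by (cases "M' = 0") (auto simp: field_simps)
  qed auto
  also have "real (M' choose k') = real k / real M * real (M choose k)"
  proof -
    have "Suc M' * (M' choose k') = (Suc M' choose Suc k') * Suc k'"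
      by (rule Suc_times_binomial_eq)
    then have "real (Suc M') * real (M' choose k') = real (Suc M' choose Suc k') * real (Suc k')"
      by (metis of_nat_mult)
    then show ?thesis
      unfolding km by (simp add: field_simps del: binomial_Suc_Suc)
  qed
  finally show ?case
    by (simp add: mult_ac)
qed

text \<open>Divided by the number of all \<open>k\<close>-subsets, this count is the probability
  that a random \<open>k\<close>-subset contains \<open>T\<close>; by
  \<open>binomial_ratio_le\<close> it is at most what independent sampling would give.\<close>

lemma card_supersets_of_size:
  assumes "finite U" "T \<subseteq> U"
  shows "card {S. S \<subseteq> U \<and> card S = k \<and> T \<subseteq> S} =
    (if card T \<le> k then (card U - card T) choose (k - card T) else 0)"
proof (cases "card T \<le> k")
  case True
  have fT: "finite T" using assms finite_subset by auto
  have "bij_betw (\<lambda>R. R \<union> T) {R. R \<subseteq> U - T \<and> card R = k - card T}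
      {S. S \<subseteq> U \<and> card S = k \<and> T \<subseteq> S}"
  proof (rule bij_betw_byWitness[where f' = "\<lambda>S. S - T"])
    show "(\<lambda>R. R \<union> T) ` {R. R \<subseteq> U - T \<and> card R = k - card T} \<subseteq> {S. S \<subseteq> U \<and> card S = k \<and> T \<subseteq> S}"
    proof clarsimp
      fix R assume R: "R \<subseteq> U - T" "card R = k - card T"
      have "card (R \<union> T) = card R + card T"
        using R assms fT by (intro card_Un_disjoint) (auto intro: finite_subset)
      then show "R \<subseteq> U \<and> T \<subseteq> U \<and> card (R \<union> T) = k"
        using R assms True by auto
    qed
    show "(\<lambda>S. S - T) ` {S. S \<subseteq> U \<and> card S = k \<and> T \<subseteq> S} \<subseteq> {R. R \<subseteq> U - T \<and> card R = k - card T}"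
      using fT by (auto simp: card_Diff_subset)
  qed auto
  then have "card {S. S \<subseteq> U \<and> card S = k \<and> T \<subseteq> S} = card {R. R \<subseteq> U - T \<and> card R = k - card T}"
    by (rule bij_betw_same_card[symmetric])
  also have "\<dots> = (card (U - T)) choose (k - card T)"
    using assms by (intro n_subsets) auto
  finally show ?thesis
    using True assms fT by (simp add: card_Diff_subset)
next
  case False
  have "{S. S \<subseteq> U \<and> card S = k \<and> T \<subseteq> S} = {}"
    using False assms(1) by (auto dest: card_mono[rotated] intro: finite_subset)
  then show ?thesis using False by (simp only: if_False card.empty)
qed

lemma one_plus_power_card:
  fixes z :: real
  assumes "finite B"
  shows "(1 + z) ^ card B = (\<Sum>T\<in>Pow B. z ^ card T)"
proof -
  have "(1 + z) ^ card B = (\<Prod>i\<in>B. 1 + z)" by simp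
  also have "\<dots> = (\<Prod>i\<in>B. z + 1)" by (simp add: add.commute)
  also have "\<dots> = (\<Sum>T\<in>Pow B. (\<Prod>i\<in>T. z) * (\<Prod>i\<in>B-T. 1))"
    by (rule prod_add[OF assms])
  finally show ?thesis by simp
qed

text \<open>Expand each power over the subsets \<open>T\<close> of \<open>S \<inter> A\<close> and
  exchange the sums. At most a fraction \<open>(k / card U) ^ card T\<close> of the sets
  \<open>S\<close> contains \<open>T\<close>, and the weights \<open>z ^ card T\<close> are
  nonnegative, so the sum is dominated by the one for independent points.\<close>

lemma sum_power_card_Int_le:
  fixes z :: real
  assumes U: "finite U" "k \<le> card U" and A: "A \<subseteq> U" and z: "z \<ge> 0"
  shows "(\<Sum>S | S \<subseteq> U \<and> card S = k. (1 + z) ^ card (S \<inter> A))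
    \<le> real (card U choose k) * (1 + real k / real (card U) * z) ^ card A"
proof -
  let ?Fam = "{S. S \<subseteq> U \<and> card S = k}"
  have fin: "finite ?Fam" using U(1) by simp
  have fA: "finite A" using A U(1) finite_subset by blast
  have "(\<Sum>S\<in>?Fam. (1 + z) ^ card (S \<inter> A)) = (\<Sum>S\<in>?Fam. \<Sum>T\<in>{T\<in>Pow A. T \<subseteq> S}. z ^ card T)"
  proof (rule sum.cong[OF refl])
    fix S assume "S \<in> ?Fam"
    then have "finite (S \<inter> A)" using fA by auto
    moreover have "Pow (S \<inter> A) = {T\<in>Pow A. T \<subseteq> S}" by auto
    ultimately show "(1 + z) ^ card (S \<inter> A) = (\<Sum>T\<in>{T\<in>Pow A. T \<subseteq> S}. z ^ card T)"
      by (simp add: one_plus_power_card)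
  qed
  also have "\<dots> = (\<Sum>T\<in>Pow A. \<Sum>S\<in>{S\<in>?Fam. T \<subseteq> S}. z ^ card T)"
    by (rule sum.swap_restrict) (use fin fA in auto)
  also have "\<dots> = (\<Sum>T\<in>Pow A. z ^ card T * real (card {S. S \<subseteq> U \<and> card S = k \<and> T \<subseteq> S}))"
    by (simp add: mult.commute conj_assoc)
  also have "\<dots> \<le> (\<Sum>T\<in>Pow A. z ^ card T * ((real k / real (card U)) ^ card T * real (card U choose k)))"
  proof (intro sum_mono mult_left_mono)
    fix T assume "T \<in> Pow A"
    then have "T \<subseteq> U" using A by auto
    then show "real (card {S. S \<subseteq> U \<and> card S = k \<and> T \<subseteq> S}) \<le> (real k / real (card U)) ^ card T * real (card U choose k)"
      using binomial_ratio_le[of "card T" k "card U"] U by (simp add: card_supersets_of_size)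
  qed (use z in auto)
  also have "\<dots> = real (card U choose k) * (\<Sum>T\<in>Pow A. (real k / real (card U) * z) ^ card T)"
    by (simp add: sum_distrib_left power_mult_distrib power_divide mult_ac)
  also have "\<dots> = real (card U choose k) * (1 + real k / real (card U) * z) ^ card A"
    by (simp add: one_plus_power_card fA)
  finally show ?thesis .
qed

text \<open>For bases below \<open>1\<close>, pass to the complement of \<open>S\<close>: a uniformly random set of the complementary size.\<close>

lemma sum_power_card_Int_le':
  fixes y :: real
  assumes U: "finite U" "k \<le> card U" "card U > 0" and A: "A \<subseteq> U" and y: "0 < y" "y \<le> 1"
  shows "(\<Sum>S | S \<subseteq> U \<and> card S = k. y ^ card (S \<inter> A))
    \<le> real (card U choose k) * (1 - real k / real (card U) * (1 - y)) ^ card A"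
proof -
  let ?M = "card U"
  have fA: "finite A" using A U(1) finite_subset by blast
  \<comment> \<open>With \<open>R = U - S\<close>,
    \<open>card (S \<inter> A) = card A - card (R \<inter> A)\<close>. The base for \<open>R\<close>
    is therefore \<open>1 / y \<ge> 1\<close>, written as \<open>1 + (1 / y - 1)\<close> to fit
    \<open>sum_power_card_Int_le\<close>.\<close>
  have "(\<Sum>S | S \<subseteq> U \<and> card S = k. y ^ card (S \<inter> A)) =
    (\<Sum>R | R \<subseteq> U \<and> card R = ?M - k. y ^ card A * (1 + (1 / y - 1)) ^ card (R \<inter> A))"
  proof (rule sum.reindex_bij_witness[where i = "\<lambda>R. U - R" and j = "\<lambda>R. U - R"])
    fix S assume S: "S \<in> {S. S \<subseteq> U \<and> card S = k}"
    show "U - (U - S) = S" using S by auto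
    show "U - S \<in> {R. R \<subseteq> U \<and> card R = ?M - k}"
      using S U by (auto simp: card_Diff_subset finite_subset)
    have "card A = card (S \<inter> A) + card ((U - S) \<inter> A)"
      using A fA by (subst card_Un_disjoint[symmetric]) (auto intro: arg_cong[where f = card])
    then show "y ^ card A * (1 + (1 / y - 1)) ^ card ((U - S) \<inter> A) = y ^ card (S \<inter> A)"
      using y by (simp add: power_add power_divide)
  next
    fix R assume R: "R \<in> {R. R \<subseteq> U \<and> card R = ?M - k}"
    show "U - (U - R) = R" using R by auto
    show "U - R \<in> {S. S \<subseteq> U \<and> card S = k}"
      using R U by (auto simp: card_Diff_subset finite_subset)
  qed
  also have "\<dots> = y ^ card A * (\<Sum>R | R \<subseteq> U \<and> card R = ?M - k. (1 + (1 / y - 1)) ^ card (R \<inter> A))"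
    by (simp add: sum_distrib_left)
  also have "\<dots> \<le> y ^ card A * (real (?M choose (?M - k)) * (1 + real (?M - k) / real ?M * (1 / y - 1)) ^ card A)"
    using y by (intro mult_left_mono sum_power_card_Int_le U A) (auto simp: field_simps)
  also have "\<dots> = real (?M choose k) * (y * (1 + real (?M - k) / real ?M * (1 / y - 1))) ^ card A"
    using binomial_symmetric[OF U(2)] by (simp add: power_mult_distrib mult_ac)
  also have "y * (1 + real (?M - k) / real ?M * (1 / y - 1)) = 1 - real k / real ?M * (1 - y)"
  proof -
    have "real (?M - k) / real ?M = 1 - real k / real ?M"
      using U(2,3) by (simp add: diff_divide_distrib del: card_gt_0_iff)
    then have "1 + real (?M - k) / real ?M * (1 / y - 1) = 1 + (1 - real k / real ?M) * (1 / y - 1)"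
      by (simp only:)
    then show ?thesis
      using y by (simp only:) (simp add: algebra_simps)
  qed
  finally show ?thesis .
qed

text \<open>The moment generating function is at most that of a binomial variable, and
  \<open>1 + t \<le> exp t\<close> turns this into the Poisson form. The sign of \<open>x\<close>
  decides between the bounds for bases above and below \<open>1\<close>.\<close>

lemma sum_exp_card_Int_le:
  fixes x :: real
  assumes U: "finite U" "k \<le> card U" "card U > 0" and A: "A \<subseteq> U"
  shows "(\<Sum>S | S \<subseteq> U \<and> card S = k. exp (x * real (card (S \<inter> A))))
    \<le> real (card U choose k) * exp (real k / real (card U) * real (card A) * (exp x - 1))"
proof -
  define p where "p = real k / real (card U)"
  have e: "exp (x * real j) = (exp x) ^ j" for j
    by (metis exp_of_nat_mult mult.commute)
  have p: "p \<le> 1" "p \<ge> 0" using U by (auto simp: p_def)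
  have "(\<Sum>S | S \<subseteq> U \<and> card S = k. exp (x * real (card (S \<inter> A))))
      \<le> real (card U choose k) * (1 + p * (exp x - 1)) ^ card A"
  proof (cases "x \<ge> 0")
    case True
    then show ?thesis
      using sum_power_card_Int_le[OF U(1,2) A, of "exp x - 1"] by (simp add: e p_def)
  next
    case False
    then show ?thesis
      using sum_power_card_Int_le'[OF U A, of "exp x"]
      by (simp add: e p_def[symmetric] algebra_simps)
  qed
  also have "\<dots> \<le> real (card U choose k) * exp (p * (exp x - 1)) ^ card A"
  proof (intro mult_left_mono power_mono)
    have "p * (1 - exp x) \<le> 1"
    proof (cases "exp x \<le> 1")
      case True
      then show ?thesis using p mult_mono[of p 1 "1 - exp x" 1] by simp
    next
      case False
      then show ?thesis using p mult_nonneg_nonpos[of p "1 - exp x"] by simp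
    qed
    then show "0 \<le> 1 + p * (exp x - 1)" by (simp add: algebra_simps)
  qed auto
  also have "exp (p * (exp x - 1)) ^ card A = exp (p * real (card A) * (exp x - 1))"
    by (simp add: exp_of_nat_mult[symmetric] mult_ac)
  finally show ?thesis by (simp add: p_def)
qed

text \<open>For negative \<open>x = - y\<close>, \<open>exp (- y)\<close> is at most the reciprocal
  of the quadratic Taylor polynomial of \<open>exp y\<close>; multiplying out shows that this is at
  most \<open>1 - y + y * y\<close>.\<close>

lemma exp_minus_one_le:
  fixes x :: real
  assumes "\<bar>x\<bar> \<le> 1"
  shows "exp x - 1 \<le> x + x\<^sup>2"
proof (cases "x \<ge> 0")
  case True
  then show ?thesis using exp_bound[of x] assms by auto
next
  case False
  define y where "y = - x"
  have y: "0 \<le> y" "y \<le> 1" using False assms by (auto simp: y_def)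
  have "1 + y + y\<^sup>2 / 2 \<le> exp y" using exp_lower_Taylor_quadratic[of y] y by simp
  then have "exp (- y) \<le> 1 / (1 + y + y\<^sup>2 / 2)"
    using y by (simp add: exp_minus divide_simps add_pos_nonneg)
  also have "\<dots> \<le> 1 - y + y\<^sup>2"
  proof -
    have "1 \<le> (1 - y + y\<^sup>2) * (1 + y + y\<^sup>2 / 2)"
    proof -
      have "(1 - y + y\<^sup>2) * (1 + y + y\<^sup>2 / 2) = 1 + y\<^sup>2/2 + y^3/2 + y^4/2"
        by (simp add: field_simps power2_eq_square power3_eq_cube power4_eq_xxxx)
      then show ?thesis using y by simp
    qed
    then show ?thesis using y by (simp add: divide_simps add_pos_nonneg)
  qed
  finally show ?thesis by (simp add: y_def)
qed

text \<open>Markov's inequality for \<open>exp (\<sigma> * x * card (S \<inter> A))\<close>, in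
  counting form. The sign \<open>\<sigma>\<close> selects the tail, and \<open>v\<close> may be any
  upper bound for the mean that is at least \<open>L\<close>.\<close>

lemma card_one_sided_deviation_le:
  fixes L v C \<sigma> :: real
  assumes U: "finite U" "k \<le> card U" "card U > 0" and A: "A \<subseteq> U"
    and L: "0 < L" "L \<le> v" and mu: "real k / real (card U) * real (card A) \<le> v"
    and \<sigma>: "\<bar>\<sigma>\<bar> = 1"
  shows "real (card {S. (S \<subseteq> U \<and> card S = k) \<and>
      \<sigma> * (real (card (S \<inter> A)) - real k / real (card U) * real (card A)) > C * sqrt (L * v)})
    \<le> exp (- (C - 1) * L) * real (card U choose k)"
proof -
  define mu' where "mu' = real k / real (card U) * real (card A)"
  \<comment> \<open>For this \<open>x\<close> the deviation contributes \<open>C * L\<close> to the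
    exponent, while the quadratic term is at most \<open>v * (L / v) = L\<close>; this leaves
    \<open>- (C - 1) * L\<close>. The condition \<open>L \<le> v\<close> keeps \<open>x\<close> in
    the range of \<open>exp_minus_one_le\<close>.\<close>
  define x where "x = sqrt (L / v)"
  have x: "0 < x" "x \<le> 1" "x\<^sup>2 = L / v" "x * sqrt (L * v) = L"
    using L by (auto simp: x_def real_sqrt_mult[symmetric])
  have mu0: "0 \<le> mu'" "mu' \<le> v" using mu by (auto simp: mu'_def)
  let ?Fam = "{S. S \<subseteq> U \<and> card S = k}"
  let ?B = "{S. (S \<subseteq> U \<and> card S = k) \<and> \<sigma> * (real (card (S \<inter> A)) - mu') > C * sqrt (L * v)}"
  have fin: "finite ?Fam" using U(1) by simp
  have sub: "?B \<subseteq> ?Fam" by auto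
  have "real (card ?B) * exp (C * L + \<sigma> * x * mu') = (\<Sum>S\<in>?B. exp (C * L + \<sigma> * x * mu'))" by simp
  also have "\<dots> \<le> (\<Sum>S\<in>?B. exp (\<sigma> * x * real (card (S \<inter> A))))"
  proof (rule sum_mono)
    fix S assume "S \<in> ?B"
    then have "x * (C * sqrt (L * v)) \<le> x * (\<sigma> * (real (card (S \<inter> A)) - mu'))"
      using x by (intro mult_left_mono) auto
    moreover have "x * (C * sqrt (L * v)) = C * L" using x(4) by (metis mult.left_commute)
    moreover have "x * (\<sigma> * (real (card (S \<inter> A)) - mu')) = \<sigma> * x * real (card (S \<inter> A)) - \<sigma> * x * mu'"
      by (simp add: algebra_simps)
    ultimately show "exp (C * L + \<sigma> * x * mu') \<le> exp (\<sigma> * x * real (card (S \<inter> A)))"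
      by simp
  qed
  also have "\<dots> \<le> (\<Sum>S\<in>?Fam. exp (\<sigma> * x * real (card (S \<inter> A))))"
    by (rule sum_mono2[OF fin sub]) auto
  also have "\<dots> \<le> real (card U choose k) * exp (mu' * (exp (\<sigma> * x) - 1))"
    using sum_exp_card_Int_le[OF U A, of "\<sigma> * x"] by (simp add: mu'_def)
  also have "\<dots> \<le> real (card U choose k) * exp (\<sigma> * x * mu' + L)"
  proof -
    have s2: "\<sigma>\<^sup>2 = 1" using \<sigma> by (metis power2_abs one_power2)
    have "mu' * (exp (\<sigma> * x) - 1) \<le> mu' * (\<sigma> * x + (\<sigma> * x)\<^sup>2)"
      using mu0 x \<sigma> by (intro mult_left_mono exp_minus_one_le) (auto simp: abs_mult)
    also have "\<dots> = \<sigma> * x * mu' + mu' * (L / v)"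
      using x s2 by (simp add: algebra_simps power_mult_distrib)
    also have "mu' * (L / v) \<le> v * (L / v)" using mu0 L by (intro mult_right_mono) auto
    also have "v * (L / v) = L" using L by simp
    finally show ?thesis by (intro mult_left_mono) auto
  qed
  finally have *: "real (card ?B) * exp (C * L + \<sigma> * x * mu') \<le> real (card U choose k) * exp (\<sigma> * x * mu' + L)" .
  have "real (card ?B) = real (card ?B) * exp (C * L + \<sigma> * x * mu') * exp (- (C * L + \<sigma> * x * mu'))"
    by (simp add: mult.assoc exp_add[symmetric])
  also have "\<dots> \<le> real (card U choose k) * exp (\<sigma> * x * mu' + L) * exp (- (C * L + \<sigma> * x * mu'))"
    using * by (rule mult_right_mono) auto
  also have "\<dots> = exp (- (C - 1) * L) * real (card U choose k)"
    by (simp add: mult.assoc exp_add[symmetric] algebra_simps)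
  finally show ?thesis by (simp add: mu'_def)
qed

lemma card_deviation_le:
  fixes L v C :: real
  assumes U: "finite U" "k \<le> card U" "card U > 0" and A: "A \<subseteq> U"
    and L: "0 < L" "L \<le> v" and mu: "real k / real (card U) * real (card A) \<le> v"
  shows "real (card {S. (S \<subseteq> U \<and> card S = k) \<and>
      \<bar>real (card (S \<inter> A)) - real k / real (card U) * real (card A)\<bar> > C * sqrt (L * v)})
    \<le> 2 * exp (- (C - 1) * L) * real (card U choose k)"
proof -
  let ?B = "\<lambda>\<sigma>. {S. (S \<subseteq> U \<and> card S = k) \<and>
      \<sigma> * (real (card (S \<inter> A)) - real k / real (card U) * real (card A)) > C * sqrt (L * v)}"
  let ?D = "{S. (S \<subseteq> U \<and> card S = k) \<and>
      \<bar>real (card (S \<inter> A)) - real k / real (card U) * real (card A)\<bar> > C * sqrt (L * v)}"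
  have "?D \<subseteq> ?B 1 \<union> ?B (-1)" by auto
  moreover have "finite (?B 1 \<union> ?B (-1))" using U(1) by simp
  ultimately have "card ?D \<le> card (?B 1) + card (?B (-1))"
    by (meson card_Un_le card_mono le_trans)
  then have "real (card ?D) \<le> real (card (?B 1)) + real (card (?B (-1)))" by linarith
  then show ?thesis
    using card_one_sided_deviation_le[OF U A L mu, of 1 C] card_one_sided_deviation_le[OF U A L mu, of "-1" C]
    by linarith
qed

subsection \<open>Cutting a box\<close>

text \<open>The corners are functions of the coordinate, so that cutting along \<open>j\<close> is a
  function update at \<open>j\<close>.\<close>

definition int_box :: "nat \<Rightarrow> (nat \<Rightarrow> int) \<Rightarrow> (nat \<Rightarrow> int) \<Rightarrow> int list set" where
  "int_box d \<alpha> \<beta> = {y. length y = d \<and> (\<forall>i<d. \<alpha> i \<le> y ! i \<and> y ! i \<le> \<beta> i)}"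

lemma bij_betw_PiE_int_box: "bij_betw (\<lambda>h. map h [0..<d]) (PiE {..<d} (\<lambda>i. {\<alpha> i..\<beta> i})) (int_box d \<alpha> \<beta>)"
proof (rule bij_betw_byWitness[where f' = "\<lambda>y. restrict ((!) y) {..<d}"])
  show "(\<lambda>h. map h [0..<d]) ` (PiE {..<d} (\<lambda>i. {\<alpha> i..\<beta> i})) \<subseteq> int_box d \<alpha> \<beta>"
    by (auto simp: int_box_def PiE_def Pi_def)
  show "(\<lambda>y. restrict ((!) y) {..<d}) ` int_box d \<alpha> \<beta> \<subseteq> PiE {..<d} (\<lambda>i. {\<alpha> i..\<beta> i})"
    by (auto simp: int_box_def PiE_iff split: if_splits)
  show "\<forall>h\<in>PiE {..<d} (\<lambda>i. {\<alpha> i..\<beta> i}). restrict ((!) (map h [0..<d])) {..<d} = h"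
  proof (intro ballI ext)
    fix h k assume h: "h \<in> PiE {..<d} (\<lambda>i. {\<alpha> i..\<beta> i})"
    show "restrict ((!) (map h [0..<d])) {..<d} k = h k"
      using PiE_arb[OF h, of k] by (cases "k < d") auto
  qed
  show "\<forall>y\<in>int_box d \<alpha> \<beta>. map (restrict ((!) y) {..<d}) [0..<d] = y"
    by (auto simp: int_box_def intro!: nth_equalityI)
qed

lemma finite_int_box: "finite (int_box d \<alpha> \<beta>)"
  using bij_betw_finite[OF bij_betw_PiE_int_box] by (simp add: finite_PiE)

text \<open>The hypothesis admits an empty side \<open>\<beta> i = \<alpha> i - 1\<close>, whose
  factor is \<open>0\<close>; a still smaller \<open>\<beta> i\<close> would give a negative
  factor.\<close>

lemma card_int_box:
  assumes "\<And>i. i < d \<Longrightarrow> \<alpha> i \<le> \<beta> i + 1"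
  shows "real (card (int_box d \<alpha> \<beta>)) = (\<Prod>i<d. real_of_int (\<beta> i - \<alpha> i + 1))"
proof -
  have "card (int_box d \<alpha> \<beta>) = (\<Prod>i<d. card {\<alpha> i..\<beta> i})"
    by (simp add: bij_betw_same_card[OF bij_betw_PiE_int_box, symmetric] card_PiE)
  then have "real (card (int_box d \<alpha> \<beta>)) = (\<Prod>i<d. real (card {\<alpha> i..\<beta> i}))"
    by simp
  also have "\<dots> = (\<Prod>i<d. real_of_int (\<beta> i - \<alpha> i + 1))"
    by (rule prod.cong) (use assms in \<open>auto simp: nat_add_distrib algebra_simps\<close>)
  finally show ?thesis .
qed

text \<open>Serves to write the volume of a cut box as its side along \<open>j\<close> times a
  cross-section that the cut does not change.\<close>

lemma prod_fun_upd_both: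
  fixes h :: "'a \<Rightarrow> 'a \<Rightarrow> 'b::comm_monoid_mult"
  assumes "j < (d::nat)"
  shows "(\<Prod>i<d. h' ((f(j := x)) i) ((g(j := y)) i)) = h' x y * (\<Prod>i\<in>{..<d}-{j}. h' (f i) (g i))"
proof -
  have "(\<Prod>i<d. h' ((f(j := x)) i) ((g(j := y)) i)) =
      h' x y * (\<Prod>i\<in>{..<d}-{j}. h' ((f(j := x)) i) ((g(j := y)) i))"
    using assms by (subst prod.remove[of _ j]) auto
  also have "(\<Prod>i\<in>{..<d}-{j}. h' ((f(j := x)) i) ((g(j := y)) i)) = (\<Prod>i\<in>{..<d}-{j}. h' (f i) (g i))"
    by (rule prod.cong) auto
  finally show ?thesis .
qed

text \<open>Each step moves a minimiser among the remaining points. Ties at \<open>c\<close> may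
  fall on either side, hence the two weak inequalities; \<open>c\<close> is an attained value, so it
  stays between the faces of the source box.\<close>

lemma ordered_split:
  fixes h :: "'a \<Rightarrow> int"
  assumes "finite X" "1 \<le> k" "k \<le> card X"
  shows "\<exists>Y c. Y \<subseteq> X \<and> card Y = k \<and> c \<in> h ` X \<and> (\<forall>x\<in>Y. h x \<le> c) \<and> (\<forall>x\<in>X - Y. c \<le> h x)"
  using assms(2,3)
proof (induction k rule: dec_induct)
  case base
  then have "X \<noteq> {}" by auto
  then obtain x where "x \<in> X" "\<forall>y\<in>X. h x \<le> h y"
    using ex_is_arg_min_if_finite[OF assms(1), of h] by (auto simp: is_arg_min_linorder)
  then show ?case by (intro exI[of _ "{x}"] exI[of _ "h x"]) auto
next
  case (step k)
  then obtain Y c where Y: "Y \<subseteq> X" "card Y = k" "\<forall>x\<in>Y. h x \<le> c" "\<forall>x\<in>X - Y. c \<le> h x"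
    by auto
  have fY: "finite Y" using Y assms finite_subset by auto
  have "X - Y \<noteq> {}" using Y step.prems by auto
  then obtain x where x: "x \<in> X - Y" "\<forall>y\<in>X-Y. h x \<le> h y"
    using ex_is_arg_min_if_finite[of "X - Y" h] assms(1) by (auto simp: is_arg_min_linorder)
  have "c \<le> h x" using x Y by auto
  then show ?case
    using x Y fY by (intro exI[of _ "insert x Y"] exI[of _ "h x"]) force
qed

section \<open>Position of a cut determined by point counts\<close>

lemma cut_estimate_upper:
  fixes l r A Am Ap E P Q K y \<epsilon> :: real
  assumes pos: "0 < l" "0 < r" "0 < Am" "Am \<le> Ap" "0 \<le> A" "0 \<le> y" "0 \<le> E"
    and P: "l * A \<le> (P + 2) * Ap + E" and Q: "(Q - 2) * Am - E \<le> r * A"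
    and "Ap * (1 - y) \<le> Am" "A \<le> K * Am" "E \<le> \<epsilon> * Am"
  shows "l * Q - r * P \<le> (l + r) * (2 + \<epsilon>) + l * r * K * y"
proof -
  have Ap: "0 < Ap" using pos by linarith
  have EAm: "E / Am \<le> \<epsilon>" using assms by (simp add: field_simps)
  have EAp: "E / Ap \<le> E / Am" using pos Ap by (intro divide_left_mono) auto
  \<comment> \<open>The lower count bound caps the width \<open>Q\<close> of one part, and the upper
    count bound forces a minimal width \<open>P\<close> of the other. What remains is the gap
    between \<open>A / Am\<close> and \<open>A / Ap\<close>, controlled by the relative spread
    \<open>y\<close> of the cross-sections.\<close>
  have 1: "Q \<le> 2 + r * (A / Am) + \<epsilon>"
  proof -
    have "Q \<le> 2 + r * (A / Am) + E / Am" using divide_right_mono[OF Q, of Am] pos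
      by (simp add: diff_divide_distrib)
    then show ?thesis using EAm by linarith
  qed
  have 2: "P \<ge> l * (A / Ap) - 2 - \<epsilon>"
  proof -
    have "P \<ge> l * (A / Ap) - 2 - E / Ap" using divide_right_mono[OF P, of Ap] Ap
      by (simp add: add_divide_distrib)
    then show ?thesis using EAm EAp by linarith
  qed
  have 3: "A / Am - A / Ap \<le> K * y"
  proof -
    have "A / Am - A / Ap = (A / Am) * (1 - Am / Ap)" using pos Ap by (simp add: field_simps)
    also have "\<dots> \<le> K * y"
    proof (rule mult_mono)
      show "A / Am \<le> K" using assms by (simp add: field_simps)
      show "1 - Am / Ap \<le> y" using assms Ap by (simp add: field_simps)
      show "0 \<le> K" using \<open>A / Am \<le> K\<close> pos by (meson divide_nonneg_pos order_trans)
      show "0 \<le> 1 - Am / Ap" using pos Ap by simp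
    qed
    finally show ?thesis .
  qed
  have "l * Q - r * P \<le> l * (2 + r * (A / Am) + \<epsilon>) - r * (l * (A / Ap) - 2 - \<epsilon>)"
    using 1 2 pos by (intro diff_mono mult_left_mono) auto
  also have "\<dots> = (l + r) * (2 + \<epsilon>) + l * r * (A / Am - A / Ap)" by (simp add: algebra_simps)
  also have "l * r * (A / Am - A / Ap) \<le> l * r * (K * y)" using 3 pos by (intro mult_left_mono) auto
  finally show ?thesis by (simp add: mult.assoc)
qed

text \<open>Applying \<open>cut_estimate_upper\<close> with \<open>P = c - a\<close> and
  \<open>Q = b - c\<close>, and again with the parts exchanged, bounds the deviation from the ratio
  \<open>l : r\<close> in both directions. The bound \<open>\<kappa>\<close> on
  \<open>y * (l + r)\<close> removes the dependence on the side length.\<close>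

lemma cut_estimate:
  fixes l r A Am Ap E a b c \<alpha> \<beta> \<gamma> e K y \<epsilon> \<kappa> :: real
  assumes pos: "0 < l" "0 < r" "0 < Am" "Am \<le> Ap" "0 \<le> A" "0 \<le> y" "0 \<le> E" "0 \<le> K"
    and cl: "(c - a - 2) * Am - E \<le> l * A" "l * A \<le> (c - a + 2) * Ap + E"
    and cr: "(b - c - 2) * Am - E \<le> r * A" "r * A \<le> (b - c + 2) * Ap + E"
    and A: "Ap * (1 - y) \<le> Am" "A \<le> K * Am" "E \<le> \<epsilon> * Am"
    and y: "y * (l + r) \<le> \<kappa>"
    and g: "\<gamma> = \<alpha> + l - 1" "\<beta> = \<alpha> + l + r - 1"
    and e: "\<bar>a - \<alpha>\<bar> \<le> e" "\<bar>b - \<beta>\<bar> \<le> e"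
  shows "\<bar>c - \<gamma>\<bar> \<le> e + (3 + \<epsilon> + K * \<kappa>)" "\<bar>c - (\<gamma> + 1)\<bar> \<le> e + (3 + \<epsilon> + K * \<kappa>)"
proof -
  define u where "u = l + r"
  have u: "u > 0" using pos by (simp add: u_def)
  define D where "D = 2 + \<epsilon> + K * \<kappa>"
  have k: "l * r * K * y \<le> u * (K * \<kappa>)"
  proof -
    have "l * r \<le> u * u" using pos by (intro mult_mono) (auto simp: u_def)
    then have "l * r * (K * y) \<le> u * u * (K * y)" using pos by (intro mult_right_mono) auto
    also have "\<dots> = u * (K * (y * (l + r)))" by (simp add: u_def)
    also have "\<dots> \<le> u * (K * \<kappa>)" using y u pos by (intro mult_left_mono) auto
    finally show ?thesis by (simp add: mult.assoc)
  qed
  have 1: "l * (b - c) - r * (c - a) \<le> u * D"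
    using cut_estimate_upper[OF pos(1-7) cl(2) cr(1) A] k
    by (simp add: u_def[symmetric] D_def algebra_simps)
  have 2: "r * (c - a) - l * (b - c) \<le> u * D"
    using cut_estimate_upper[OF pos(2,1) pos(3-7) cr(2) cl(1) A] k
    by (simp add: u_def[symmetric] D_def algebra_simps add.commute[of r l])
  have ea: "r * \<bar>a - \<alpha>\<bar> + l * \<bar>b - \<beta>\<bar> \<le> r * e + l * e"
    using e pos by (intro add_mono mult_left_mono) auto
  have h1: "\<bar>r * (a - \<alpha>)\<bar> = r * \<bar>a - \<alpha>\<bar>" "\<bar>l * (b - \<beta>)\<bar> = l * \<bar>b - \<beta>\<bar>"
    using pos by (auto simp: abs_mult)
  \<comment> \<open>The weights \<open>r\<close> and \<open>l\<close> add up to \<open>u\<close>, so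
    the end errors enter as a convex combination and \<open>e\<close> is not multiplied. The
    summands \<open>r\<close> here and \<open>- l\<close> below arise because the ideal cut lies
    between the cells \<open>\<gamma>\<close> and \<open>\<gamma> + 1\<close>.\<close>
  have id: "u * (c - \<gamma>) = r * (a - \<alpha>) + l * (b - \<beta>) + r - (l * (b - c) - r * (c - a))"
    by (simp add: g u_def algebra_simps)
  have id': "u * (c - (\<gamma> + 1)) = r * (a - \<alpha>) + l * (b - \<beta>) - l - (l * (b - c) - r * (c - a))"
    by (simp add: g u_def algebra_simps)
  have "\<bar>u * (c - \<gamma>)\<bar> \<le> (r * e + l * e) + r + u * D"
    unfolding id using 1 2 ea h1 pos by linarith
  also have "\<dots> \<le> u * (e + (3 + \<epsilon> + K * \<kappa>))" using pos by (simp add: u_def D_def algebra_simps)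
  finally show "\<bar>c - \<gamma>\<bar> \<le> e + (3 + \<epsilon> + K * \<kappa>)" using u by (simp add: abs_mult)
  have "\<bar>u * (c - (\<gamma> + 1))\<bar> \<le> (r * e + l * e) + l + u * D"
    unfolding id' using 1 2 ea h1 pos by linarith
  also have "\<dots> \<le> u * (e + (3 + \<epsilon> + K * \<kappa>))" using pos by (simp add: u_def D_def algebra_simps)
  finally show "\<bar>c - (\<gamma> + 1)\<bar> \<le> e + (3 + \<epsilon> + K * \<kappa>)" using u by (simp add: abs_mult)
qed

text \<open>
  A box of \<open>b i - a i + 1\<close> cells in each direction has side lengths \<open>b i - a i\<close> to \<open>b i - a i + 2\<close>
  after rounding. The error term is monotone in \<open>v\<close>, so that one value of \<open>v\<close> serves all
  sub-boxes of a box.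
\<close>

definition well_spread :: "nat \<Rightarrow> nat \<Rightarrow> real \<Rightarrow> real \<Rightarrow> ('a \<Rightarrow> nat \<Rightarrow> int) \<Rightarrow> 'a set \<Rightarrow> bool" where
  "well_spread d n C L g S \<longleftrightarrow>
    (\<forall>a b v. (\<forall>i<d. 1 \<le> a i \<and> a i \<le> b i \<and> b i \<le> int n) \<longrightarrow> L \<le> v \<longrightarrow>
      (\<Prod>i<d. real_of_int (b i - a i + 2)) \<le> v \<longrightarrow>
      real (card {x \<in> S. \<forall>i<d. a i \<le> g x i \<and> g x i \<le> b i})
        \<in> {(\<Prod>i<d. real_of_int (b i - a i)) - C * sqrt (L * v) ..
           (\<Prod>i<d. real_of_int (b i - a i + 2)) + C * sqrt (L * v)})"

text \<open>The increment in \<open>cut_estimate\<close> for \<open>K = 2 ^ d\<close> and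
  \<open>\<kappa> = 24 * d\<close>. The middle summand is the discrepancy relative to the
  cross-section of a box whose longest side is at least \<open>2 * s\<close>.\<close>

definition step_error :: "nat \<Rightarrow> real \<Rightarrow> real \<Rightarrow> real \<Rightarrow> real" where
  "step_error d C L s = 3 + 2 ^ d * C * sqrt (6 ^ d * L * (1 / s) ^ (d - 2)) + 2 ^ d * (24 * real d)"

text \<open>
  The left part of the target has \<open>l * A\<close> points and the right part \<open>r * A\<close>, where \<open>A\<close> is the
  cross-section; the same numbers of source points lie in the two source boxes, whose cross-sections
  are between \<open>Am\<close> and \<open>Ap\<close> up to rounding. So \<open>c\<close> divides \<open>{a j..b j}\<close> almost in the ratio \<open>l : r\<close>, and its error is
  little more than a convex combination of the errors at the two ends.
\<close>

lemma split_step: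
  fixes \<alpha> \<beta> a b :: "nat \<Rightarrow> int" and s e C L :: real
  assumes d: "2 \<le> d" and ws: "well_spread d n C L g S" and S: "finite S" and X: "X \<subseteq> S"
    and C: "0 \<le> C" and L: "0 < L" "L \<le> s" and s: "18 \<le> s" and e: "0 \<le> e" "e \<le> s / 12"
    and ab: "\<And>i. i < d \<Longrightarrow> 1 \<le> a i" "\<And>i. i < d \<Longrightarrow> b i \<le> int n"
    and ea: "\<And>i. i < d \<Longrightarrow> \<bar>real_of_int (a i - \<alpha> i)\<bar> \<le> e"
    and eb: "\<And>i. i < d \<Longrightarrow> \<bar>real_of_int (b i - \<beta> i)\<bar> \<le> e"
    and inner: "\<And>x. x \<in> S \<Longrightarrow> (\<And>i. i < d \<Longrightarrow> a i < g x i \<and> g x i < b i) \<Longrightarrow> x \<in> X"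
    and outer: "\<And>x i. x \<in> X \<Longrightarrow> i < d \<Longrightarrow> a i \<le> g x i \<and> g x i \<le> b i"
    and cardX: "card X = card (int_box d \<alpha> \<beta>)"
    and j: "j < d" "\<And>i. i < d \<Longrightarrow> \<beta> i - \<alpha> i \<le> \<beta> j - \<alpha> j"
      "\<And>i. i < d \<Longrightarrow> \<beta> j - \<alpha> j + 1 \<le> 3 * (\<beta> i - \<alpha> i + 1)"
    and big: "2 * s \<le> real_of_int (\<beta> j - \<alpha> j + 1)"
    and \<gamma>: "\<alpha> j \<le> \<gamma>" "\<gamma> < \<beta> j"
  shows "\<exists>Y c. Y \<subseteq> X \<and> card Y = card (int_box d \<alpha> (\<beta>(j := \<gamma>))) \<and> a j \<le> c \<and> c \<le> b j \<and>
    (\<forall>x\<in>Y. g x j \<le> c) \<and> (\<forall>x\<in>X - Y. c \<le> g x j) \<and>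
    \<bar>real_of_int (c - \<gamma>)\<bar> \<le> e + step_error d C L s \<and>
    \<bar>real_of_int (c - (\<gamma> + 1))\<bar> \<le> e + step_error d C L s"
proof -
  define I where "I = {..<d} - {j}"
  define w where "w i = real_of_int (b i - a i)" for i
  define u where "u i = real_of_int (\<beta> i - \<alpha> i + 1)" for i
  define A where "A = prod u I"
  define Am where "Am = (\<Prod>i\<in>I. w i - 2)"
  define Ap where "Ap = (\<Prod>i\<in>I. w i + 2)"
  have fI: "finite I" "card I = d - 1" using j by (auto simp: I_def)
  have u_j: "u i \<le> u j" "u j \<le> 3 * u i" if "i < d" for i
  proof -
    have "real_of_int (\<beta> i - \<alpha> i) \<le> real_of_int (\<beta> j - \<alpha> j)"
      using j(2)[OF that] by (simp only: of_int_le_iff)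
    moreover have "real_of_int (\<beta> j - \<alpha> j + 1) \<le> real_of_int (3 * (\<beta> i - \<alpha> i + 1))"
      using j(3)[OF that] by (simp only: of_int_le_iff)
    ultimately show "u i \<le> u j" "u j \<le> 3 * u i" by (simp_all add: u_def)
  qed
  have uj: "2 * s \<le> u j" using big by (simp add: u_def)
  have u_big: "12 \<le> u i" "s \<le> 3 / 2 * u i" if "i < d" for i
    using u_j[OF that] uj s by linarith+
  \<comment> \<open>The two end errors amount to at most \<open>s / 6 \<le> u i / 4\<close>, and
    \<open>u i \<ge> 12\<close> absorbs the remaining shift by \<open>3\<close>.\<close>
  have w_lo: "u i / 2 \<le> w i - 2" and w_hi: "w i + 2 \<le> 2 * u i" if "i < d" for i
  proof -
    have "\<bar>real_of_int (a i) - real_of_int (\<alpha> i)\<bar> \<le> e" "\<bar>real_of_int (b i) - real_of_int (\<beta> i)\<bar> \<le> e"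
      using ea[OF that] eb[OF that] by simp_all
    moreover have "w i = real_of_int (b i) - real_of_int (a i)" "u i = real_of_int (\<beta> i) - real_of_int (\<alpha> i) + 1"
      by (simp_all add: w_def u_def)
    ultimately show "u i / 2 \<le> w i - 2" "w i + 2 \<le> 2 * u i"
      using u_big[OF that] e s by linarith+
  qed
  have \<alpha>\<beta>: "\<alpha> i \<le> \<beta> i" if "i < d" for i
    using u_big[OF that] by (simp add: u_def)
  have ab': "a i + 2 < b i" if "i < d" for i
    using w_lo[OF that] u_big[OF that] unfolding w_def by linarith
  have A_pos: "0 < A" unfolding A_def using u_big by (intro prod_pos) (force simp: I_def)
  have Am_pos: "0 < Am"
    unfolding Am_def
  proof (intro prod_pos)
    fix i assume "i \<in> I"
    then show "0 < w i - 2" using w_lo[of i] u_big[of i] by (simp add: I_def)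
  qed
  have Ap_pos: "0 < Ap"
    unfolding Ap_def
  proof (intro prod_pos)
    fix i assume "i \<in> I"
    then show "0 < w i + 2" using w_lo[of i] u_big[of i] by (simp add: I_def)
  qed
  have Am_le_Ap: "Am \<le> Ap"
    unfolding Am_def Ap_def
  proof (intro prod_mono)
    fix i assume "i \<in> I"
    then show "0 \<le> w i - 2 \<and> w i - 2 \<le> w i + 2" using w_lo[of i] u_big[of i] by (simp add: I_def)
  qed
  have A_le_Am: "A \<le> 2 ^ d * Am"
  proof -
    have "A \<le> (\<Prod>i\<in>I. 2 * (w i - 2))"
      unfolding A_def
    proof (intro prod_mono)
      fix i assume "i \<in> I"
      then show "0 \<le> u i \<and> u i \<le> 2 * (w i - 2)" using w_lo[of i] u_big[of i] by (simp add: I_def)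
    qed
    also have "\<dots> = 2 ^ (d - 1) * Am" using fI by (simp add: prod.distrib Am_def del: right_diff_distrib_numeral)
    also have "\<dots> \<le> 2 ^ d * Am" using Am_pos by (intro mult_right_mono power_increasing) auto
    finally show ?thesis .
  qed
  \<comment> \<open>Chosen so that \<open>(w i + 2) * (1 - y) \<le> w i - 2\<close>: this needs
    \<open>y * (w i + 2) \<ge> 4\<close>, and \<open>u j \<le> 6 * (w i + 2)\<close>. Bernoulli's
    inequality then turns the product over \<open>I\<close> into a relative spread of
    \<open>d * y\<close>.\<close>
  define y where "y = 24 / u j"
  have y: "0 \<le> y" "y \<le> 1" using u_big[OF j(1)] uj s by (auto simp: y_def)
  have y_Ap: "Ap * (1 - d * y) \<le> Am"
  proof -
    have "Ap * (1 - d * y) \<le> Ap * (1 - real (card I) * y)"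
      using Ap_pos y fI by (intro mult_left_mono) (auto intro!: mult_right_mono)
    also have "\<dots> \<le> Ap * (1 - y) ^ card I"
      using Bernoulli_inequality[of "- y" "card I"] y Ap_pos by (intro mult_left_mono) auto
    also have "\<dots> = (\<Prod>i\<in>I. (w i + 2) * (1 - y))"
      by (simp add: Ap_def prod.distrib)
    also have "\<dots> \<le> Am"
      unfolding Am_def
    proof (intro prod_mono)
      fix i assume "i \<in> I"
      then have i: "i < d" by (simp add: I_def)
      have "u i \<le> 2 * w i - 4" using w_lo[OF i] by simp
      then have "u j \<le> 6 * (w i + 2)" using u_j(2)[OF i] by simp
      then have "4 \<le> y * (w i + 2)"
        using u_big[OF j(1)] by (simp add: y_def field_simps)
      moreover have "0 \<le> (w i + 2) * (1 - y)"
        using y w_lo[OF i] u_big[OF i] by simp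
      ultimately show "0 \<le> (w i + 2) * (1 - y) \<and> (w i + 2) * (1 - y) \<le> w i - 2"
        by (simp add: algebra_simps)
    qed
    finally show ?thesis .
  qed
  define m where "m = (\<Prod>i<d. u i)"
  have m: "m = u j * A" unfolding m_def A_def I_def using j(1) by (intro prod.remove) auto
  \<comment> \<open>This is the product of the \<open>2 * u i\<close>, which by \<open>w_hi\<close>
    dominates the enlarged volume of every sub-box counted below.\<close>
  define v where "v = 2 ^ d * m"
  have one_le_A: "1 \<le> A"
    unfolding A_def using u_big by (intro prod_ge_1) (force simp: I_def)
  have v_L: "L \<le> v"
  proof -
    have "L \<le> u j" using L uj s by linarith
    also have "\<dots> \<le> u j * A" using one_le_A u_big[OF j(1)] by simp
    also have "\<dots> \<le> 2 ^ d * (u j * A)" using one_le_A u_big[OF j(1)] by simp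
    finally show ?thesis by (simp add: v_def m)
  qed
  define E where "E = C * sqrt (L * v)"
  have E0: "0 \<le> E" using C L v_L by (simp add: E_def)
  define \<epsilon> where "\<epsilon> = 2 ^ d * C * sqrt (6 ^ d * L * (1 / s) ^ (d - 2))"
  have E_le: "E \<le> \<epsilon> * Am"
  proof -
    have s_pow: "0 < s ^ (d - 2)" using s by simp
    \<comment> \<open>Here the bounded aspect ratio enters: \<open>u j ^ (d - 1)\<close> is at most
      a constant times the cross-section \<open>A\<close>. Hence \<open>sqrt (L * v)\<close>, of
      order \<open>sqrt (L * u j * A)\<close>, is small relative to \<open>A\<close>.\<close>
    have "u j \<le> 3 ^ d * A * (1 / s) ^ (d - 2)"
    proof -
      have "u j * s ^ (d - 2) \<le> u j * u j ^ (d - 2)"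
        using s uj by (intro mult_left_mono power_mono) auto
      also have "\<dots> = u j ^ (d - 1)" using d by (metis Suc_diff_Suc Suc_le_eq numeral_2_eq_2 power_Suc One_nat_def)
      also have "\<dots> = (\<Prod>i\<in>I. u j)" using fI by simp
      also have "\<dots> \<le> (\<Prod>i\<in>I. 3 * u i)"
      proof (intro prod_mono)
        fix i assume "i \<in> I"
        then show "0 \<le> u j \<and> u j \<le> 3 * u i" using u_j[of i] u_big[OF j(1)] by (simp add: I_def)
      qed
      also have "\<dots> = 3 ^ (d - 1) * A" using fI by (simp add: prod.distrib A_def)
      also have "\<dots> \<le> 3 ^ d * A" using A_pos by (intro mult_right_mono power_increasing) auto
      finally show ?thesis using s_pow by (simp add: field_simps)
    qed
    then have "u j * A \<le> 3 ^ d * A * (1 / s) ^ (d - 2) * A"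
      using A_pos by (intro mult_right_mono) auto
    then have "L * (2 ^ d * (u j * A)) \<le> L * (2 ^ d * (3 ^ d * A * (1 / s) ^ (d - 2) * A))"
      using L by (intro mult_left_mono) auto
    also have "\<dots> = 6 ^ d * L * (1 / s) ^ (d - 2) * A\<^sup>2"
    proof -
      have "(6::real) ^ d = 2 ^ d * 3 ^ d" by (simp flip: power_mult_distrib)
      then show ?thesis by (simp add: power2_eq_square mult_ac)
    qed
    finally have "sqrt (L * v) \<le> sqrt (6 ^ d * L * (1 / s) ^ (d - 2) * A\<^sup>2)"
      by (simp add: v_def m)
    also have "\<dots> = sqrt (6 ^ d * L * (1 / s) ^ (d - 2)) * A"
      using A_pos by (simp add: real_sqrt_mult)
    finally have "E \<le> C * (sqrt (6 ^ d * L * (1 / s) ^ (d - 2)) * A)"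
      unfolding E_def using C by (intro mult_left_mono)
    also have "\<dots> \<le> C * (sqrt (6 ^ d * L * (1 / s) ^ (d - 2)) * (2 ^ d * Am))"
      using C L s A_le_Am by (intro mult_left_mono) auto
    finally show ?thesis by (simp add: \<epsilon>_def mult_ac)
  qed

  \<comment> \<open>By \<open>outer\<close>, the source box narrowed to \<open>{p..q}\<close> along
    \<open>j\<close> contains all of \<open>Z\<close>.\<close>
  have upper: "real (card Z) \<le> real_of_int (q - p + 2) * Ap + E"
    if pq: "a j \<le> p" "p \<le> q" "q \<le> b j" and Z: "Z \<subseteq> X" "\<And>x. x \<in> Z \<Longrightarrow> p \<le> g x j \<and> g x j \<le> q" for p q Z
  proof -
    let ?a = "a(j := p)" and ?b = "b(j := q)"
    have eq: "(\<Prod>i<d. real_of_int (?b i - ?a i + 2)) = real_of_int (q - p + 2) * Ap"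
      using prod_fun_upd_both[OF j(1), of "\<lambda>x y. real_of_int (x - y + 2)" b q a p]
      by (simp add: Ap_def w_def I_def)
    have "real_of_int (q - p + 2) * Ap \<le> (\<Prod>i<d. 2 * u i)"
    proof -
      have "real_of_int (q - p + 2) * Ap \<le> (w j + 2) * Ap"
        using pq Ap_pos by (intro mult_right_mono) (auto simp: w_def)
      also have "\<dots> = (\<Prod>i<d. w i + 2)"
        unfolding Ap_def I_def using j(1) by (intro prod.remove[symmetric]) auto
      also have "\<dots> \<le> (\<Prod>i<d. 2 * u i)"
      proof (intro prod_mono)
        fix i assume "i \<in> {..<d}"
        then show "0 \<le> w i + 2 \<and> w i + 2 \<le> 2 * u i" using w_hi[of i] w_lo[of i] u_big[of i] by simp
      qed
      finally show ?thesis .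
    qed
    also have "\<dots> = v" by (simp add: v_def m_def prod.distrib)
    finally have v: "(\<Prod>i<d. real_of_int (?b i - ?a i + 2)) \<le> v" by (simp only: eq)
    have "\<forall>i<d. 1 \<le> ?a i \<and> ?a i \<le> ?b i \<and> ?b i \<le> int n"
    proof (intro allI impI)
      fix i assume i: "i < d"
      show "1 \<le> ?a i \<and> ?a i \<le> ?b i \<and> ?b i \<le> int n"
        using ab(1,2)[OF i] ab'[OF i] pq by (cases "i = j") auto
    qed
    with ws v v_L have "real (card {x \<in> S. \<forall>i<d. ?a i \<le> g x i \<and> g x i \<le> ?b i}) \<le>
        (\<Prod>i<d. real_of_int (?b i - ?a i + 2)) + C * sqrt (L * v)"
      unfolding well_spread_def atLeastAtMost_iff by blast
    moreover have "card Z \<le> card {x \<in> S. \<forall>i<d. ?a i \<le> g x i \<and> g x i \<le> ?b i}"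
      using S X Z outer by (intro card_mono) (auto simp: subset_iff)
    ultimately show ?thesis unfolding eq E_def by linarith
  qed
  have lower: "real_of_int (q - p - 2) * Am - E \<le> real (card Z)"
    if pq: "a j \<le> p" "q \<le> b j" and Z: "finite Z" "\<And>x. x \<in> X \<Longrightarrow> p < g x j \<Longrightarrow> g x j < q \<Longrightarrow> x \<in> Z" for p q Z
  proof (cases "p + 2 < q")
    case False
    then have "real_of_int (q - p - 2) * Am \<le> 0"
      using Am_pos by (intro mult_nonpos_nonneg) auto
    then show ?thesis using E0 by linarith
  next
    case pq': True
    \<comment> \<open>Moving every face inwards by one cell makes the inequalities strict, so
      \<open>inner\<close> places the counted points in \<open>X\<close>. The lower volume bound
      then has the factors \<open>(b i - 1) - (a i + 1)\<close>, whence the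
      \<open>- 2\<close>.\<close>
    let ?a = "(\<lambda>i. a i + 1)(j := p + 1)" and ?b = "(\<lambda>i. b i - 1)(j := q - 1)"
    have eq: "(\<Prod>i<d. real_of_int (?b i - ?a i)) = real_of_int (q - p - 2) * Am"
      using prod_fun_upd_both[OF j(1), of "\<lambda>x y. real_of_int (x - y)" "\<lambda>i. b i - 1" "q - 1" "\<lambda>i. a i + 1" "p + 1"]
      by (simp add: Am_def w_def I_def algebra_simps)
    have "(\<Prod>i<d. real_of_int (?b i - ?a i + 2)) \<le> (\<Prod>i<d. 2 * u i)"
    proof (intro prod_mono)
      fix i assume "i \<in> {..<d}"
      then have i: "i < d" by simp
      show "0 \<le> real_of_int (?b i - ?a i + 2) \<and> real_of_int (?b i - ?a i + 2) \<le> 2 * u i"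
        using w_hi[OF i] w_lo[OF i] u_big[OF i] pq pq' by (cases "i = j") (auto simp: w_def)
    qed
    also have "\<dots> = v" by (simp add: v_def m_def prod.distrib)
    finally have v: "(\<Prod>i<d. real_of_int (?b i - ?a i + 2)) \<le> v" .
    have "\<forall>i<d. 1 \<le> ?a i \<and> ?a i \<le> ?b i \<and> ?b i \<le> int n"
    proof (intro allI impI)
      fix i assume i: "i < d"
      show "1 \<le> ?a i \<and> ?a i \<le> ?b i \<and> ?b i \<le> int n"
        using ab(1,2)[OF i] ab'[OF i] pq pq' by (cases "i = j") auto
    qed
    with ws v v_L have "(\<Prod>i<d. real_of_int (?b i - ?a i)) - C * sqrt (L * v)
        \<le> real (card {x \<in> S. \<forall>i<d. ?a i \<le> g x i \<and> g x i \<le> ?b i})"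
      unfolding well_spread_def atLeastAtMost_iff by blast
    moreover have "{x \<in> S. \<forall>i<d. ?a i \<le> g x i \<and> g x i \<le> ?b i} \<subseteq> Z"
    proof clarify
      fix x assume x: "x \<in> S" "\<forall>i<d. ?a i \<le> g x i \<and> g x i \<le> ?b i"
      have pj: "p < g x j" "g x j < q" using x(2)[rule_format, OF j(1)] by auto
      have "a i < g x i \<and> g x i < b i" if "i < d" for i
        using x(2)[rule_format, OF that] pj pq by (cases "i = j") auto
      then show "x \<in> Z" using inner[OF x(1)] Z(2) pj by blast
    qed
    then have "card {x \<in> S. \<forall>i<d. ?a i \<le> g x i \<and> g x i \<le> ?b i} \<le> card Z"
      using Z(1) by (intro card_mono)
    ultimately show ?thesis unfolding eq E_def by linarith
  qed

  define l where "l = real_of_int (\<gamma> - \<alpha> j + 1)"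
  define r where "r = real_of_int (\<beta> j - \<gamma>)"
  have lr: "0 < l" "0 < r" "l + r = u j" using \<gamma> by (auto simp: l_def r_def u_def)
  have card_left: "real (card (int_box d \<alpha> (\<beta>(j := \<gamma>)))) = l * A"
  proof -
    have "\<alpha> i \<le> (\<beta>(j := \<gamma>)) i + 1" if "i < d" for i
      using \<alpha>\<beta>[OF that] \<gamma> by (cases "i = j") auto
    then have "real (card (int_box d \<alpha> (\<beta>(j := \<gamma>)))) = (\<Prod>i<d. real_of_int ((\<beta>(j := \<gamma>)) i - (\<alpha>(j := \<alpha> j)) i + 1))"
      by (subst card_int_box) auto
    also have "\<dots> = l * A"
      using prod_fun_upd_both[OF j(1), of "\<lambda>x y. real_of_int (x - y + 1)" \<beta> \<gamma> \<alpha> "\<alpha> j"]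
      by (simp add: l_def A_def u_def I_def)
    finally show ?thesis .
  qed
  have card_all: "real (card X) = (l + r) * A"
  proof -
    have "\<alpha> i \<le> \<beta> i + 1" if "i < d" for i
      using \<alpha>\<beta>[OF that] by simp
    then have "real (card X) = m"
      unfolding cardX m_def u_def by (rule card_int_box)
    then show ?thesis by (simp add: lr m)
  qed
  have fX: "finite X" using S X finite_subset by auto
  have "1 \<le> real (card (int_box d \<alpha> (\<beta>(j := \<gamma>))))"
    unfolding card_left using \<gamma> one_le_A mult_mono[of 1 l 1 A] by (auto simp: l_def)
  moreover have "real (card (int_box d \<alpha> (\<beta>(j := \<gamma>)))) \<le> real (card X)"
    unfolding card_left card_all using lr A_pos by (intro mult_right_mono) auto
  ultimately obtain Y c where Y: "Y \<subseteq> X" "card Y = card (int_box d \<alpha> (\<beta>(j := \<gamma>)))"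
      "c \<in> (\<lambda>x. g x j) ` X" "\<forall>x\<in>Y. g x j \<le> c" "\<forall>x\<in>X - Y. c \<le> g x j"
    using ordered_split[OF fX, of "card (int_box d \<alpha> (\<beta>(j := \<gamma>)))" "\<lambda>x. g x j"] by auto
  have c: "a j \<le> c" "c \<le> b j" using Y(3) outer j(1) by auto
  have cY: "real (card Y) = l * A" using Y card_left by simp
  have cXY: "real (card (X - Y)) = r * A"
    using card_all cY Y(1) fX by (simp add: card_Diff_subset finite_subset card_mono of_nat_diff algebra_simps)
  have fin: "finite Y" "finite (X - Y)" using fX Y finite_subset by auto
  have 1: "(real_of_int c - real_of_int (a j) - 2) * Am - E \<le> l * A"
    using lower[of "a j" c Y] c Y fin by (force simp: cY[symmetric])
  have 2: "l * A \<le> (real_of_int c - real_of_int (a j) + 2) * Ap + E"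
    using upper[of "a j" c Y] c Y outer j(1) by (force simp: cY[symmetric])
  have 3: "(real_of_int (b j) - real_of_int c - 2) * Am - E \<le> r * A"
    using lower[of c "b j" "X - Y"] c Y fin by (force simp: cXY[symmetric])
  have 4: "r * A \<le> (real_of_int (b j) - real_of_int c + 2) * Ap + E"
    using upper[of c "b j" "X - Y"] c Y outer j(1) by (force simp: cXY[symmetric])
  have 5: "d * y * (l + r) \<le> 24 * d"
    using u_big[OF j(1)] by (simp add: lr y_def)
  have 6: "\<bar>real_of_int (a j) - real_of_int (\<alpha> j)\<bar> \<le> e" "\<bar>real_of_int (b j) - real_of_int (\<beta> j)\<bar> \<le> e"
    using ea[OF j(1)] eb[OF j(1)] by auto
  have 7: "real_of_int \<gamma> = real_of_int (\<alpha> j) + l - 1" "real_of_int (\<beta> j) = real_of_int (\<alpha> j) + l + r - 1"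
    by (auto simp: l_def r_def)
  have 8: "0 \<le> d * y" "0 \<le> A" "(0::real) \<le> 2 ^ d" using y A_pos by auto
  note est = cut_estimate[OF lr(1,2) Am_pos Am_le_Ap 8(2,1) E0 8(3) 1 2 3 4 y_Ap A_le_Am E_le 5 7 6]
  then show ?thesis
    using Y c by (intro exI[of _ Y] exI[of _ c]) (auto simp: step_error_def \<epsilon>_def)
qed

subsection \<open>Transport onto a box\<close>

lemma step_error_nonneg:
  assumes "0 \<le> C" "0 \<le> L" "0 < s"
  shows "0 \<le> step_error d C L s"
  using assms by (simp add: step_error_def)

text \<open>
  Each split increases the error \<open>e\<close> by \<open>step_error\<close> and decreases \<open>2 * log 2 (card X)\<close> by at least \<open>1\<close>
  (both halves have at most two thirds of the points), which makes the bound by \<open>emax\<close> an invariant.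
  Points of \<open>S\<close> on the boundary of the source box may or may not belong to \<open>X\<close>.
\<close>

lemma transport_into_box:
  fixes \<alpha> \<beta> a b :: "nat \<Rightarrow> int" and s e emax C L :: real
  assumes d: "2 \<le> d" and ws: "well_spread d n C L g S" and S: "finite S"
    and C: "0 \<le> C" and L: "0 < L" "L \<le> s" and s: "18 \<le> s" and emax: "emax \<le> s / 12"
    and X: "X \<subseteq> S"
    and e: "0 \<le> e" "e + 2 * step_error d C L s * log 2 (real (card X)) \<le> emax"
    and \<alpha>\<beta>: "\<And>i. i < d \<Longrightarrow> \<alpha> i \<le> \<beta> i"
    and ab: "\<And>i. i < d \<Longrightarrow> 1 \<le> a i" "\<And>i. i < d \<Longrightarrow> b i \<le> int n"
    and ea: "\<And>i. i < d \<Longrightarrow> \<bar>real_of_int (a i - \<alpha> i)\<bar> \<le> e"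
    and eb: "\<And>i. i < d \<Longrightarrow> \<bar>real_of_int (b i - \<beta> i)\<bar> \<le> e"
    and inner: "\<And>x. x \<in> S \<Longrightarrow> (\<And>i. i < d \<Longrightarrow> a i < g x i \<and> g x i < b i) \<Longrightarrow> x \<in> X"
    and outer: "\<And>x i. x \<in> X \<Longrightarrow> i < d \<Longrightarrow> a i \<le> g x i \<and> g x i \<le> b i"
    and cardX: "card X = card (int_box d \<alpha> \<beta>)"
    and ratio: "\<And>i i'. i < d \<Longrightarrow> i' < d \<Longrightarrow> \<beta> i - \<alpha> i + 1 \<le> 3 * (\<beta> i' - \<alpha> i' + 1)"
  shows "\<exists>f. bij_betw f X (int_box d \<alpha> \<beta>) \<and>
    (\<forall>x\<in>X. \<forall>i<d. \<bar>real_of_int (f x ! i - g x i)\<bar> \<le> 3 * s)"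
  using X e \<alpha>\<beta> ab ea eb inner outer cardX ratio
proof (induction "card X" arbitrary: X \<alpha> \<beta> a b e rule: less_induct)
  case less
  let ?\<delta> = "step_error d C L s"
  have \<delta>: "0 \<le> ?\<delta>" using C L s by (intro step_error_nonneg) auto
  have fX: "finite X" using less.prems(1) S finite_subset by auto
  have cX: "real (card X) = (\<Prod>i<d. real_of_int (\<beta> i - \<alpha> i + 1))"
    unfolding less.prems(11) using less.prems(4) by (intro card_int_box) force
  have "1 \<le> real (card X)"
    unfolding cX
  proof (intro prod_ge_1)
    fix i assume "i \<in> {..<d}"
    then show "1 \<le> real_of_int (\<beta> i - \<alpha> i + 1)" using less.prems(4)[of i] by simp
  qed
  then have log0: "0 \<le> log 2 (real (card X))" by simp
  have "0 \<le> 2 * ?\<delta> * log 2 (real (card X))" using \<delta> log0 by simp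
  then have e12: "e \<le> s / 12" using less.prems(3) emax by linarith
  show ?case
  proof (cases "\<forall>i<d. real_of_int (\<beta> i - \<alpha> i + 1) < 2 * s")
    case True
    \<comment> \<open>The value \<open>f x ! i\<close> lies between \<open>\<alpha> i\<close> and
      \<open>\<beta> i\<close>, and \<open>g x i\<close> in the same interval widened by
      \<open>e\<close>, so they differ by less than \<open>2 * s + e\<close>.\<close>
    obtain f where f: "bij_betw f X (int_box d \<alpha> \<beta>)"
      using finite_same_card_bij[OF fX finite_int_box less.prems(11)] by blast
    have "\<bar>real_of_int (f x ! i - g x i)\<bar> \<le> 3 * s" if "x \<in> X" "i < d" for x i
    proof -
      have "f x \<in> int_box d \<alpha> \<beta>" using f that by (auto simp: bij_betw_def)
      then have 1: "\<alpha> i \<le> f x ! i" "f x ! i \<le> \<beta> i" using that by (auto simp: int_box_def)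
      have 2: "a i \<le> g x i" "g x i \<le> b i" using less.prems(10)[OF that] by auto
      show ?thesis
        using 1 2 True[rule_format, OF that(2)] less.prems(7)[OF that(2)] less.prems(8)[OF that(2)] e12 s
        by linarith
    qed
    then show ?thesis using f by blast
  next
    case False
    obtain j where j: "j < d" "\<And>i. i < d \<Longrightarrow> \<beta> i - \<alpha> i \<le> \<beta> j - \<alpha> j"
      using ex_is_arg_min_if_finite[of "{..<d}" "\<lambda>i. - (\<beta> i - \<alpha> i)"] d
      by (fastforce simp: is_arg_min_linorder)
    obtain i where i: "i < d" "2 * s \<le> real_of_int (\<beta> i - \<alpha> i + 1)" using False by force
    have "real_of_int (\<beta> i - \<alpha> i) \<le> real_of_int (\<beta> j - \<alpha> j)"
      using j(2)[OF i(1)] by (simp only: of_int_le_iff)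
    then have big: "2 * s \<le> real_of_int (\<beta> j - \<alpha> j + 1)" using i(2) by simp
    define u where "u = \<beta> j - \<alpha> j + 1"
    define l where "l = u div 2"
    define \<gamma> where "\<gamma> = \<alpha> j + l - 1"
    have "36 \<le> real_of_int u" using big s by (simp add: u_def)
    then have u: "36 \<le> u" by simp
    have l: "2 * l \<le> u" "u \<le> 2 * l + 1" by (auto simp: l_def)
    have \<gamma>: "\<alpha> j \<le> \<gamma>" "\<gamma> < \<beta> j" using u l by (auto simp: \<gamma>_def u_def)
    obtain Y c where Y: "Y \<subseteq> X" "card Y = card (int_box d \<alpha> (\<beta>(j := \<gamma>)))" "a j \<le> c" "c \<le> b j"
      "\<And>x. x \<in> Y \<Longrightarrow> g x j \<le> c" "\<And>x. x \<in> X - Y \<Longrightarrow> c \<le> g x j"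
      "\<bar>real_of_int (c - \<gamma>)\<bar> \<le> e + ?\<delta>" "\<bar>real_of_int (c - (\<gamma> + 1))\<bar> \<le> e + ?\<delta>"
      using split_step[OF d ws S less.prems(1) C L s less.prems(2) e12 less.prems(5-11) j less.prems(12)[OF j(1)] big \<gamma>]
      by blast
    have fY: "finite Y" "finite (X - Y)" using fX Y(1) finite_subset by auto
    define A where "A = (\<Prod>i\<in>{..<d}-{j}. real_of_int (\<beta> i - \<alpha> i + 1))"
    have A: "1 \<le> A"
      unfolding A_def
    proof (intro prod_ge_1)
      fix i assume "i \<in> {..<d} - {j}"
      then show "1 \<le> real_of_int (\<beta> i - \<alpha> i + 1)" using less.prems(4)[of i] by simp
    qed
    have cX': "real (card X) = real_of_int u * A"
      unfolding cX A_def u_def using j(1) by (intro prod.remove) auto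
    have le1: "\<alpha> i \<le> (\<beta>(j := \<gamma>)) i" if "i < d" for i
      using less.prems(4)[OF that] \<gamma> by (cases "i = j") auto
    have le2: "(\<alpha>(j := \<gamma> + 1)) i \<le> \<beta> i" if "i < d" for i
      using less.prems(4)[OF that] \<gamma> by (cases "i = j") auto
    have cY: "real (card Y) = real_of_int l * A"
    proof -
      have "real (card Y) = (\<Prod>i<d. real_of_int ((\<beta>(j := \<gamma>)) i - (\<alpha>(j := \<alpha> j)) i + 1))"
        unfolding Y(2) using le1 by (subst card_int_box) force+
      also have "\<dots> = real_of_int l * A"
        using prod_fun_upd_both[OF j(1), of "\<lambda>x y. real_of_int (x - y + 1)" \<beta> \<gamma> \<alpha> "\<alpha> j"]
        by (simp add: A_def \<gamma>_def)
      finally show ?thesis .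
    qed
    have cXY: "real (card (X - Y)) = real_of_int (u - l) * A"
      using cX' cY Y(1) fX by (simp add: card_Diff_subset finite_subset card_mono of_nat_diff algebra_simps)
    have box2: "real (card (int_box d (\<alpha>(j := \<gamma> + 1)) \<beta>)) = real_of_int (u - l) * A"
    proof -
      have "real (card (int_box d (\<alpha>(j := \<gamma> + 1)) \<beta>)) =
          (\<Prod>i<d. real_of_int ((\<beta>(j := \<beta> j)) i - (\<alpha>(j := \<gamma> + 1)) i + 1))"
        using le2 by (subst card_int_box) force+
      also have "\<dots> = real_of_int (u - l) * A"
        using prod_fun_upd_both[OF j(1), of "\<lambda>x y. real_of_int (x - y + 1)" \<beta> "\<beta> j" \<alpha> "\<gamma> + 1"]
        by (simp add: A_def \<gamma>_def u_def algebra_simps)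
      finally show ?thesis .
    qed
    have cXY': "card (X - Y) = card (int_box d (\<alpha>(j := \<gamma> + 1)) \<beta>)"
      using cXY box2 by linarith
    have shrink: "card Z < card X \<and> (e + ?\<delta>) + 2 * ?\<delta> * log 2 (real (card Z)) \<le> emax"
      if Z: "real (card Z) = real_of_int k * A" "1 \<le> k" "3 * k \<le> 2 * u" for Z :: "'a set" and k
    proof -
      have k: "real_of_int k \<le> 2 / 3 * real_of_int u" using Z(3) by linarith
      have Zpos: "0 < real (card Z)" using Z A by simp
      have "real (card Z) \<le> 2 / 3 * real (card X)"
        unfolding Z(1) cX' using k A mult_right_mono[of "real_of_int k" "2 / 3 * real_of_int u" A] by simp
      then have Z23: "real (card Z) \<le> 2 / 3 * real (card X)" .
      have lt: "card Z < card X" using Z23 Zpos by linarith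
      \<comment> \<open>Since \<open>(2 / 3) ^ 2 \<le> 1 / 2\<close>, the doubled logarithm drops by
        a full unit; this is the origin of the factor \<open>2\<close> in the invariant.\<close>
      have "2 * log 2 (real (card Z)) = log 2 (real (card Z) ^ 2)"
        using Zpos by (simp add: log_nat_power)
      also have "\<dots> \<le> log 2 (real (card X) ^ 2 / 2)"
      proof -
        have "real (card Z) ^ 2 \<le> (2 / 3 * real (card X)) ^ 2"
          using Z23 by (intro power_mono) auto
        also have "\<dots> \<le> real (card X) ^ 2 / 2" by (simp add: power_mult_distrib power2_eq_square)
        finally have "real (card Z) ^ 2 \<le> real (card X) ^ 2 / 2" .
        then show ?thesis using Zpos by (intro log_mono) auto
      qed
      also have "\<dots> = 2 * log 2 (real (card X)) - 1"
        using lt Zpos by (simp add: log_divide log_nat_power)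
      finally have "?\<delta> * (2 * log 2 (real (card Z))) \<le> ?\<delta> * (2 * log 2 (real (card X)) - 1)"
        using \<delta> by (intro mult_left_mono)
      then show ?thesis using lt less.prems(3) by (simp add: algebra_simps)
    qed
    have sY: "card Y < card X \<and> (e + ?\<delta>) + 2 * ?\<delta> * log 2 (real (card Y)) \<le> emax"
      using l u by (intro shrink[OF cY]) auto
    have sXY: "card (X - Y) < card X \<and> (e + ?\<delta>) + 2 * ?\<delta> * log 2 (real (card (X - Y))) \<le> emax"
      using l u by (intro shrink[OF cXY]) auto
    have e': "0 \<le> e + ?\<delta>" "e \<le> e + ?\<delta>" using less.prems(2) \<delta> by auto
    \<comment> \<open>These keep the aspect ratio at most \<open>3\<close> after the cut: the other
      sides are at most \<open>u \<le> 2 * l + 1 \<le> 3 * l\<close>, and either half is at most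
      \<open>u\<close>, hence at most three times any other side.\<close>
    have ratio_j: "u \<le> 3 * (\<beta> i - \<alpha> i + 1)" "\<beta> i - \<alpha> i + 1 \<le> u" if "i < d" for i
      using less.prems(12)[OF j(1) that] j(2)[OF that] by (auto simp: u_def)
    have "\<exists>f. bij_betw f Y (int_box d \<alpha> (\<beta>(j := \<gamma>))) \<and>
      (\<forall>x\<in>Y. \<forall>i<d. \<bar>real_of_int (f x ! i - g x i)\<bar> \<le> 3 * s)"
    proof (rule less.hyps[where e = "e + ?\<delta>" and a = a and b = "b(j := c)"])
      show "Y \<subseteq> S" using Y(1) less.prems(1) by auto
      fix i assume i: "i < d"
      show "\<alpha> i \<le> (\<beta>(j := \<gamma>)) i" using le1[OF i] .
      show "1 \<le> a i" using less.prems(5)[OF i] .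
      show "(b(j := c)) i \<le> int n" using less.prems(6)[OF i] Y(4) by auto
      show "\<bar>real_of_int (a i - \<alpha> i)\<bar> \<le> e + ?\<delta>" using less.prems(7)[OF i] e' by linarith
      show "\<bar>real_of_int ((b(j := c)) i - (\<beta>(j := \<gamma>)) i)\<bar> \<le> e + ?\<delta>"
        using less.prems(8)[OF i] e' Y(7) by (cases "i = j") auto
      fix i' assume i': "i' < d"
      show "(\<beta>(j := \<gamma>)) i - \<alpha> i + 1 \<le> 3 * ((\<beta>(j := \<gamma>)) i' - \<alpha> i' + 1)"
        using less.prems(12)[OF i i'] ratio_j[OF i] ratio_j[OF i'] l u
        by (cases "i = j"; cases "i' = j") (auto simp: \<gamma>_def)
    next
      fix x assume x: "x \<in> S" "\<And>i. i < d \<Longrightarrow> a i < g x i \<and> g x i < (b(j := c)) i"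
      have xj: "g x j < c" using x(2)[OF j(1)] by simp
      have "a i < g x i \<and> g x i < b i" if "i < d" for i
        using x(2)[OF that] xj Y(4) by (cases "i = j") auto
      then have "x \<in> X" using less.prems(9)[OF x(1)] by blast
      then show "x \<in> Y" using Y(6)[of x] xj by force
    next
      fix x i assume "x \<in> Y" "i < d"
      then show "a i \<le> g x i \<and> g x i \<le> (b(j := c)) i"
        using less.prems(10)[of x i] Y(1) Y(5)[of x] by auto
    qed (use sY e' Y(2) in auto)
    then obtain f1 where f1: "bij_betw f1 Y (int_box d \<alpha> (\<beta>(j := \<gamma>)))"
      "\<And>x i. x \<in> Y \<Longrightarrow> i < d \<Longrightarrow> \<bar>real_of_int (f1 x ! i - g x i)\<bar> \<le> 3 * s" by blast
    have "\<exists>f. bij_betw f (X - Y) (int_box d (\<alpha>(j := \<gamma> + 1)) \<beta>) \<and>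
      (\<forall>x\<in>X - Y. \<forall>i<d. \<bar>real_of_int (f x ! i - g x i)\<bar> \<le> 3 * s)"
    \<comment> \<open>Both source boxes contain the layer \<open>c\<close>, where ties were divided.
      So \<open>c\<close> is compared with \<open>\<gamma>\<close> as upper face of the first part
      and with \<open>\<gamma> + 1\<close> as lower face of the second.\<close>
    proof (rule less.hyps[where e = "e + ?\<delta>" and a = "a(j := c)" and b = b])
      show "X - Y \<subseteq> S" using less.prems(1) by auto
      fix i assume i: "i < d"
      show "(\<alpha>(j := \<gamma> + 1)) i \<le> \<beta> i" using le2[OF i] .
      show "b i \<le> int n" using less.prems(6)[OF i] .
      show "1 \<le> (a(j := c)) i" using less.prems(5)[OF i] Y(3) by auto
      show "\<bar>real_of_int (b i - \<beta> i)\<bar> \<le> e + ?\<delta>" using less.prems(8)[OF i] e' by linarith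
      show "\<bar>real_of_int ((a(j := c)) i - (\<alpha>(j := \<gamma> + 1)) i)\<bar> \<le> e + ?\<delta>"
        using less.prems(7)[OF i] e' Y(8) by (cases "i = j") auto
      fix i' assume i': "i' < d"
      show "\<beta> i - (\<alpha>(j := \<gamma> + 1)) i + 1 \<le> 3 * (\<beta> i' - (\<alpha>(j := \<gamma> + 1)) i' + 1)"
        using less.prems(12)[OF i i'] ratio_j[OF i] ratio_j[OF i'] l u
        by (cases "i = j"; cases "i' = j") (auto simp: \<gamma>_def u_def)
    next
      fix x assume x: "x \<in> S" "\<And>i. i < d \<Longrightarrow> (a(j := c)) i < g x i \<and> g x i < b i"
      have xj: "c < g x j" using x(2)[OF j(1)] by simp
      have "a i < g x i \<and> g x i < b i" if "i < d" for i
        using x(2)[OF that] xj Y(3) by (cases "i = j") auto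
      then have "x \<in> X" using less.prems(9)[OF x(1)] by blast
      then show "x \<in> X - Y" using Y(5)[of x] xj by force
    next
      fix x i assume "x \<in> X - Y" "i < d"
      then show "(a(j := c)) i \<le> g x i \<and> g x i \<le> b i"
        using less.prems(10)[of x i] Y(6)[of x] by auto
    qed (use sXY e' cXY' in auto)
    then obtain f2 where f2: "bij_betw f2 (X - Y) (int_box d (\<alpha>(j := \<gamma> + 1)) \<beta>)"
      "\<And>x i. x \<in> X - Y \<Longrightarrow> i < d \<Longrightarrow> \<bar>real_of_int (f2 x ! i - g x i)\<bar> \<le> 3 * s" by blast
    let ?f = "\<lambda>x. if x \<in> Y then f1 x else f2 x"
    have un: "int_box d \<alpha> (\<beta>(j := \<gamma>)) \<union> int_box d (\<alpha>(j := \<gamma> + 1)) \<beta> = int_box d \<alpha> \<beta>"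
    proof (intro equalityI subsetI)
      fix z assume "z \<in> int_box d \<alpha> (\<beta>(j := \<gamma>)) \<union> int_box d (\<alpha>(j := \<gamma> + 1)) \<beta>"
      then show "z \<in> int_box d \<alpha> \<beta>"
      proof
        assume "z \<in> int_box d \<alpha> (\<beta>(j := \<gamma>))"
        moreover have "(\<beta>(j := \<gamma>)) i \<le> \<beta> i" for i using \<gamma> by auto
        ultimately show ?thesis unfolding int_box_def by (auto intro: order_trans)
      next
        assume "z \<in> int_box d (\<alpha>(j := \<gamma> + 1)) \<beta>"
        moreover have "\<alpha> i \<le> (\<alpha>(j := \<gamma> + 1)) i" for i using \<gamma> by auto
        ultimately show ?thesis unfolding int_box_def by (auto intro: order_trans)
      qed
    next
      fix z assume "z \<in> int_box d \<alpha> \<beta>"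
      then show "z \<in> int_box d \<alpha> (\<beta>(j := \<gamma>)) \<union> int_box d (\<alpha>(j := \<gamma> + 1)) \<beta>"
        by (cases "z ! j \<le> \<gamma>") (auto simp: int_box_def)
    qed
    have disj: "disjnt (int_box d \<alpha> (\<beta>(j := \<gamma>))) (int_box d (\<alpha>(j := \<gamma> + 1)) \<beta>)"
    proof -
      have "z ! j \<le> \<gamma>" if "z \<in> int_box d \<alpha> (\<beta>(j := \<gamma>))" for z
        using that j(1) by (auto simp: int_box_def dest: spec[of _ j])
      moreover have "\<gamma> + 1 \<le> z ! j" if "z \<in> int_box d (\<alpha>(j := \<gamma> + 1)) \<beta>" for z
        using that j(1) by (auto simp: int_box_def dest: spec[of _ j])
      ultimately show ?thesis by (force simp: disjnt_def)
    qed
    have "bij_betw ?f (Y \<union> (X - Y)) (int_box d \<alpha> \<beta>)"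
      unfolding un[symmetric] using f1(1) f2(1) disj
      by (intro bij_betw_disjoint_Un) (auto simp: disjnt_def)
    moreover have "Y \<union> (X - Y) = X" using Y(1) by auto
    ultimately have "bij_betw ?f X (int_box d \<alpha> \<beta>)" by simp
    then show ?thesis using f1(2) f2(2) by (intro exI[of _ ?f]) auto
  qed
qed

subsection \<open>Lipschitz constants and the discrepancy event\<close>

lemma grid_eq_int_box: "grid d m = int_box d (\<lambda>_. 1) (\<lambda>_. m)"
  by (auto simp: grid_def int_box_def all_set_conv_all_nth)

lemma finite_grid: "finite (grid d m)"
  by (simp add: grid_eq_int_box finite_int_box)

lemma card_grid: "card (grid d (int m)) = m ^ d"
proof -
  have "real (card (grid d (int m))) = real (m ^ d)"
    by (simp add: grid_eq_int_box card_int_box)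
  then show ?thesis by linarith
qed

lemma edist_eq_L2_set: "edist x y = L2_set (\<lambda>i. \<bar>real_of_int (x ! i - y ! i)\<bar>) {..<length x}"
  by (simp add: edist_def L2_set_def)

lemma abs_nth_le_edist:
  assumes "i < length x"
  shows "\<bar>real_of_int (x ! i - y ! i)\<bar> \<le> edist x y"
  unfolding edist_eq_L2_set
  by (rule member_le_L2_set) (use assms in auto)

lemma one_le_edist:
  assumes "length x = length y" "x \<noteq> y"
  shows "1 \<le> edist x y"
proof -
  obtain i where i: "i < length x" "x ! i \<noteq> y ! i" using assms nth_equalityI by blast
  then have "1 \<le> \<bar>x ! i - y ! i\<bar>" by linarith
  then have "1 \<le> real_of_int \<bar>x ! i - y ! i\<bar>" by linarith
  then show ?thesis using abs_nth_le_edist[OF i(1), of y] by simp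
qed

lemma edist_le_sum: "edist x y \<le> (\<Sum>i<length x. \<bar>real_of_int (x ! i - y ! i)\<bar>)"
  unfolding edist_eq_L2_set by (rule L2_set_le_sum) simp

lemma lip_le:
  assumes "0 \<le> l" "\<And>x y. x \<in> S \<Longrightarrow> y \<in> S \<Longrightarrow> edist (f x) (f y) \<le> l * edist x y"
  shows "lip S f \<le> l"
  unfolding lip_def by (rule cInf_lower) (use assms in \<open>auto intro: bdd_belowI[of _ 0]\<close>)

text \<open>\<open>Min\<close> requires a finite set. Infinitely many total functions compete, but
  \<open>lip S f\<close> depends only on the restriction of \<open>f\<close> to \<open>S\<close>,
  which leaves finitely many values.\<close>

lemma F_le_lip:
  assumes S: "finite S" and f: "f ` S = grid d (int n)"
  shows "F d n S \<le> lip S f"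
proof -
  let ?A = "{lip S f | f. (\<forall>x\<in>S. f x \<in> grid d (int n)) \<and> f ` S = grid d (int n)}"
  have "?A \<subseteq> lip S ` (S \<rightarrow>\<^sub>E grid d (int n))"
  proof clarify
    fix h assume h: "\<forall>x\<in>S. h x \<in> grid d (int n)"
    have "lip S h = lip S (restrict h S)" by (simp add: lip_def)
    then show "lip S h \<in> lip S ` (S \<rightarrow>\<^sub>E grid d (int n))" using h by auto
  qed
  then have "finite ?A"
    using S finite_grid by (meson finite_PiE finite_imageI finite_subset)
  then show ?thesis
    unfolding F_def using f by (intro Min_le) auto
qed

section \<open>Rescaling to cells, and Lipschitz constants from displacements\<close>

definition cell :: "nat \<Rightarrow> nat \<Rightarrow> int list \<Rightarrow> nat \<Rightarrow> int" where
  "cell n N x i = \<lceil>real_of_int (x ! i) * real n / real N\<rceil>"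

text \<open>Rounding up makes cell \<open>k\<close> the half-open interval from
  \<open>(k - 1) * N / n\<close>, excluded, to \<open>k * N / n\<close>, included.\<close>

lemma cell_grid:
  assumes "0 < n" "n \<le> N" "x \<in> grid d (int N)" "i < d"
  shows "1 \<le> cell n N x i \<and> cell n N x i \<le> int n"
proof -
  have x: "1 \<le> x ! i" "x ! i \<le> int N" using assms(3,4) by (auto simp: grid_eq_int_box int_box_def)
  have N: "0 < real N" using assms by simp
  have "0 < real_of_int (x ! i) * real n / real N" using x assms(1) N by simp
  moreover have "real_of_int (x ! i) * real n \<le> real N * real n"
    using x(2) by (intro mult_right_mono) linarith+
  then have "real_of_int (x ! i) * real n / real N \<le> real n" using N by (simp add: field_simps)
  ultimately show ?thesis unfolding cell_def by (simp add: ceiling_le_iff less_ceiling_iff int_one_le_iff_zero_less)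
qed

lemma cell_diff_le:
  assumes "0 < n" "n \<le> N"
  shows "\<bar>real_of_int (cell n N x i - cell n N y i)\<bar> \<le> \<bar>real_of_int (x ! i - y ! i)\<bar> + 1"
proof -
  define p where "p = real n / real N"
  have p: "0 \<le> p" "p \<le> 1" using assms by (auto simp: p_def)
  have "\<bar>real_of_int (x ! i) * p - real_of_int (y ! i) * p\<bar> = \<bar>real_of_int (x ! i - y ! i)\<bar> * p"
    using p by (simp add: abs_mult flip: left_diff_distrib)
  also have "\<dots> \<le> \<bar>real_of_int (x ! i - y ! i)\<bar> * 1" using p by (intro mult_left_mono) auto
  finally have 1: "\<bar>real_of_int (x ! i) * p - real_of_int (y ! i) * p\<bar> \<le> \<bar>real_of_int (x ! i - y ! i)\<bar>" by simp
  have c: "real_of_int (cell n N z i) - 1 < real_of_int (z ! i) * p"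
    "real_of_int (z ! i) * p \<le> real_of_int (cell n N z i)" for z
    unfolding cell_def p_def times_divide_eq_right by linarith+
  show ?thesis using 1 c[of x] c[of y] by linarith
qed

text \<open>Scaling down is a contraction, so passing through the cells gives an additive error
  \<open>1 + 2 * D\<close> per coordinate. It becomes a factor because distinct lattice points have
  distance at least \<open>1\<close>; the \<open>d\<close> comes from bounding the Euclidean norm by
  the sum of the coordinates.\<close>

lemma F_le_of_displacement:
  assumes n: "0 < n" "n \<le> N" and S: "S \<subseteq> grid d (int N)" and D: "0 \<le> D"
    and f: "bij_betw f S (grid d (int n))"
    and disp: "\<And>x i. x \<in> S \<Longrightarrow> i < d \<Longrightarrow> \<bar>real_of_int (f x ! i - cell n N x i)\<bar> \<le> D"
  shows "F d n S \<le> real d * (2 + 2 * D)"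
proof -
  have fS: "finite S" using S finite_grid finite_subset by blast
  have "edist (f x) (f y) \<le> real d * (2 + 2 * D) * edist x y" if xy: "x \<in> S" "y \<in> S" for x y
  proof (cases "x = y")
    case True
    then show ?thesis by (simp add: edist_def)
  next
    case False
    have len: "length x = d" "length y = d" "length (f x) = d"
      using xy S f by (auto simp: grid_def bij_betw_def)
    have e1: "1 \<le> edist x y" using one_le_edist[of x y] False len by simp
    have "edist (f x) (f y) \<le> (\<Sum>i<d. \<bar>real_of_int (f x ! i - f y ! i)\<bar>)"
      using edist_le_sum[of "f x" "f y"] len by simp
    also have "\<dots> \<le> (\<Sum>i<d. (2 + 2 * D) * edist x y)"
    proof (rule sum_mono)
      fix i assume "i \<in> {..<d}"
      then have i: "i < d" by simp
      have "\<bar>real_of_int (f x ! i - f y ! i)\<bar> \<le> \<bar>real_of_int (x ! i - y ! i)\<bar> + 1 + 2 * D"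
        using disp[OF xy(1) i] disp[OF xy(2) i] cell_diff_le[OF n, of x i y] by linarith
      also have "\<dots> \<le> edist x y + (1 + 2 * D) * 1"
        using abs_nth_le_edist[of i x y] i len by simp
      also have "\<dots> \<le> edist x y + (1 + 2 * D) * edist x y"
        using e1 D by (intro add_left_mono mult_left_mono) auto
      finally show "\<bar>real_of_int (f x ! i - f y ! i)\<bar> \<le> (2 + 2 * D) * edist x y"
        by (simp add: algebra_simps)
    qed
    finally show ?thesis by simp
  qed
  then have "lip S f \<le> real d * (2 + 2 * D)" using D by (intro lip_le) auto
  moreover have "F d n S \<le> lip S f" using F_le_lip[OF fS] f by (simp add: bij_betw_def)
  ultimately show ?thesis by linarith
qed

lemma F_le_of_well_spread:
  assumes d: "2 \<le> d" and n: "0 < n" "n \<le> N" and S: "S \<subseteq> grid d (int N)" "card S = n ^ d"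
    and C: "0 \<le> C" and ws: "well_spread d n C L (cell n N) S"
    and L: "0 < L" "L \<le> s" and s: "18 \<le> s"
    and le: "2 * step_error d C L s * (real d * log 2 (real n)) \<le> s / 12"
  shows "F d n S \<le> real d * (2 + 6 * s)"
proof -
  have fS: "finite S" using S(1) finite_grid finite_subset by blast
  have log: "log 2 (real (card S)) = real d * log 2 (real n)"
    using n by (simp add: S log_nat_power)
  have "\<exists>f. bij_betw f S (int_box d (\<lambda>_. 1) (\<lambda>_. int n)) \<and>
    (\<forall>x\<in>S. \<forall>i<d. \<bar>real_of_int (f x ! i - cell n N x i)\<bar> \<le> 3 * s)"
  \<comment> \<open>The recursion starts with the whole cube as both source and target box, so the
    initial error is \<open>0\<close>.\<close>
  proof (rule transport_into_box[OF d ws fS C L s le, where e = 0 and a = "\<lambda>_. 1" and b = "\<lambda>_. int n"])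
    show "0 + 2 * step_error d C L s * log 2 (real (card S)) \<le> 2 * step_error d C L s * (real d * log 2 (real n))"
      by (simp add: log)
    show "card S = card (int_box d (\<lambda>_. 1) (\<lambda>_. int n))"
      using S(2) card_grid[of d n] by (simp add: grid_eq_int_box)
    show "1 \<le> cell n N x i \<and> cell n N x i \<le> int n" if "x \<in> S" "i < d" for x i
      using cell_grid[OF n _ that(2), of x] that S by auto
  qed (use n in auto)
  then obtain f where "bij_betw f S (grid d (int n))"
    "\<And>x i. x \<in> S \<Longrightarrow> i < d \<Longrightarrow> \<bar>real_of_int (f x ! i - cell n N x i)\<bar> \<le> 3 * s"
    by (auto simp: grid_eq_int_box)
  then show ?thesis using F_le_of_displacement[OF n S(1), of "3 * s" f] s by auto
qed

section \<open>Mean counts in boxes of cells, and the union bound\<close>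

lemma expected_cell_count:
  assumes n: "0 < n" "n \<le> N" and ab: "\<And>i. i < d \<Longrightarrow> 1 \<le> a i \<and> a i \<le> b i \<and> b i \<le> int n"
  shows "real (n ^ d) / real (N ^ d) * real (card {x \<in> grid d (int N). \<forall>i<d. a i \<le> cell n N x i \<and> cell n N x i \<le> b i})
    \<in> {\<Prod>i<d. real_of_int (b i - a i) .. \<Prod>i<d. real_of_int (b i - a i + 2)}"
proof -
  define q where "q = real N / real n"
  have q: "1 \<le> q" and nN: "real n / real N = 1 / q" using n by (auto simp: q_def)
  \<comment> \<open>A range of cells pulls back to a range of integers: \<open>lo i\<close> is the
    first integer above \<open>(a i - 1) * q\<close>, and \<open>hi i\<close> the last one not above
    \<open>b i * q\<close>.\<close>
  define lo where "lo i = \<lfloor>real_of_int (a i - 1) * q\<rfloor> + 1" for i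
  define hi where "hi i = \<lfloor>real_of_int (b i) * q\<rfloor>" for i
  have conv: "(a i \<le> cell n N x i \<and> cell n N x i \<le> b i) \<longleftrightarrow> (lo i \<le> x ! i \<and> x ! i \<le> hi i)" for x i
  proof -
    have c: "cell n N x i = \<lceil>real_of_int (x ! i) / q\<rceil>" by (simp add: cell_def q_def)
    have "a i \<le> cell n N x i \<longleftrightarrow> real_of_int (a i - 1) < real_of_int (x ! i) / q"
      unfolding c by linarith
    also have "\<dots> \<longleftrightarrow> real_of_int (a i - 1) * q < real_of_int (x ! i)"
      using q by (simp add: pos_less_divide_eq)
    also have "\<dots> \<longleftrightarrow> lo i \<le> x ! i" unfolding lo_def by linarith
    finally have 1: "a i \<le> cell n N x i \<longleftrightarrow> lo i \<le> x ! i" .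
    have "cell n N x i \<le> b i \<longleftrightarrow> real_of_int (x ! i) / q \<le> real_of_int (b i)"
      unfolding c by linarith
    also have "\<dots> \<longleftrightarrow> real_of_int (x ! i) \<le> real_of_int (b i) * q"
      using q by (simp add: pos_divide_le_eq)
    also have "\<dots> \<longleftrightarrow> x ! i \<le> hi i" unfolding hi_def by linarith
    finally show ?thesis using 1 by simp
  qed
  have lohi: "1 \<le> lo i" "hi i \<le> int N" if "i < d" for i
  proof -
    have "0 \<le> real_of_int (a i - 1) * q" using ab[OF that] q by simp
    then show "1 \<le> lo i" unfolding lo_def by linarith
    have "real_of_int (b i) * q \<le> real n * q" using ab[OF that] q by (intro mult_right_mono) linarith+
    also have "\<dots> = real N" using n by (simp add: q_def)
    finally show "hi i \<le> int N" unfolding hi_def by linarith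
  qed
  have set_eq: "{x \<in> grid d (int N). \<forall>i<d. a i \<le> cell n N x i \<and> cell n N x i \<le> b i} = int_box d lo hi"
    unfolding conv grid_eq_int_box int_box_def using lohi by (auto intro: order_trans)
  \<comment> \<open>A half-open interval of length \<open>(b i - a i + 1) * q\<close> contains that
    many integers up to an error below \<open>1 \<le> q\<close>, that is, up to one cell.\<close>
  have h: "real_of_int (b i - a i) * q \<le> real_of_int (hi i - lo i + 1)"
    "real_of_int (hi i - lo i + 1) \<le> real_of_int (b i - a i + 2) * q" if "i < d" for i
  proof -
    have h1: "real_of_int (hi i) \<le> real_of_int (b i) * q" "real_of_int (b i) * q < real_of_int (hi i) + 1"
      "real_of_int (lo i) - 1 \<le> real_of_int (a i - 1) * q" "real_of_int (a i - 1) * q < real_of_int (lo i)"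
      unfolding hi_def lo_def by linarith+
    have e: "real_of_int (b i - a i) * q = real_of_int (b i) * q - real_of_int (a i - 1) * q - q"
      "real_of_int (b i - a i + 2) * q = real_of_int (b i) * q - real_of_int (a i - 1) * q + q"
      "real_of_int (hi i - lo i + 1) = real_of_int (hi i) - (real_of_int (lo i) - 1)"
      by (simp_all add: algebra_simps)
    show "real_of_int (b i - a i) * q \<le> real_of_int (hi i - lo i + 1)"
      unfolding e using h1 q by linarith
    show "real_of_int (hi i - lo i + 1) \<le> real_of_int (b i - a i + 2) * q"
      unfolding e using h1 q by linarith
  qed
  have nonneg: "0 \<le> real_of_int (hi i - lo i + 1)" if "i < d" for i
  proof -
    have "0 \<le> real_of_int (b i - a i) * q" using ab[OF that] q by simp
    then show ?thesis using h(1)[OF that] by linarith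
  qed
  have le: "lo i \<le> hi i + 1" if "i < d" for i using nonneg[OF that] by linarith
  have eq: "real (n ^ d) / real (N ^ d) * real (card (int_box d lo hi)) = (\<Prod>i<d. real_of_int (hi i - lo i + 1) / q)"
  proof -
    have "real (n ^ d) / real (N ^ d) = (\<Prod>i<d. 1 / q)"
      using nN by (simp add: power_divide[symmetric])
    moreover have "real (card (int_box d lo hi)) = (\<Prod>i<d. real_of_int (hi i - lo i + 1))"
      using le by (rule card_int_box)
    ultimately have "real (n ^ d) / real (N ^ d) * real (card (int_box d lo hi)) =
        (\<Prod>i<d. 1 / q) * (\<Prod>i<d. real_of_int (hi i - lo i + 1))"
      by (simp only:)
    also have "\<dots> = (\<Prod>i<d. 1 / q * real_of_int (hi i - lo i + 1))"
      by (rule prod.distrib[symmetric])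
    finally show ?thesis by (simp only: times_divide_eq_left mult_1_left)
  qed
  show ?thesis
    unfolding set_eq eq atLeastAtMost_iff
  proof (rule conjI; rule prod_mono)
    fix i assume "i \<in> {..<d}"
    then have i: "i < d" by simp
    show "0 \<le> real_of_int (b i - a i) \<and> real_of_int (b i - a i) \<le> real_of_int (hi i - lo i + 1) / q"
      using h(1)[OF i] ab[OF i] q by (simp add: pos_le_divide_eq del: of_int_add of_int_diff)
    show "0 \<le> real_of_int (hi i - lo i + 1) / q \<and> real_of_int (hi i - lo i + 1) / q \<le> real_of_int (b i - a i + 2)"
    proof (rule conjI)
      show "0 \<le> real_of_int (hi i - lo i + 1) / q"
        using nonneg[OF i] q by (intro divide_nonneg_pos) linarith+
      show "real_of_int (hi i - lo i + 1) / q \<le> real_of_int (b i - a i + 2)"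
        using h(2)[OF i] q by (intro mult_imp_div_pos_le) linarith+
    qed
  qed
qed

text \<open>Union bound over pairs of corners. Only the values below \<open>d\<close> matter, so
  corners are encoded as lists from the small cube, which gives at most \<open>n ^ (2 * d)\<close>
  pairs.\<close>

lemma card_not_well_spread_le:
  fixes L :: real
  assumes n: "0 < n" "n \<le> N" and L: "0 < L" and C: "0 \<le> C"
  shows "real (card {S. (S \<subseteq> grid d (int N) \<and> card S = n ^ d) \<and> \<not> well_spread d n C L (cell n N) S})
    \<le> real (n ^ (2 * d)) * (2 * exp (- (C - 1) * L) * real (N ^ d choose n ^ d))"
proof -
  let ?U = "grid d (int N)"
  let ?G = "grid d (int n)"
  let ?P = "{z \<in> ?G \<times> ?G. \<forall>i<d. fst z ! i \<le> snd z ! i}"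
  let ?A = "\<lambda>z. {x \<in> ?U. \<forall>i<d. fst z ! i \<le> cell n N x i \<and> cell n N x i \<le> snd z ! i}"
  let ?v = "\<lambda>z. max L (\<Prod>i<d. real_of_int (snd z ! i - fst z ! i + 2))"
  let ?mu = "\<lambda>z. real (n ^ d) / real (card ?U) * real (card (?A z))"
  let ?D = "\<lambda>z. {S. (S \<subseteq> ?U \<and> card S = n ^ d) \<and> \<bar>real (card (S \<inter> ?A z)) - ?mu z\<bar> > C * sqrt (L * ?v z)}"
  let ?B = "{S. (S \<subseteq> ?U \<and> card S = n ^ d) \<and> \<not> well_spread d n C L (cell n N) S}"
  have cU: "card ?U = N ^ d" by (rule card_grid)
  have U: "finite ?U" "n ^ d \<le> card ?U" "0 < card ?U"
    using n by (auto simp: finite_grid cU intro: power_mono)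
  have muz: "?mu z \<in> {\<Prod>i<d. real_of_int (snd z ! i - fst z ! i) .. \<Prod>i<d. real_of_int (snd z ! i - fst z ! i + 2)}"
    if z: "z \<in> ?P" for z
    unfolding cU
    by (rule expected_cell_count[OF n]) (use z in \<open>auto simp: grid_eq_int_box int_box_def\<close>)
  have finP: "finite ?P" using finite_grid by simp
  have "?B \<subseteq> (\<Union>z\<in>?P. ?D z)"
  proof (rule ccontr)
    assume "\<not> ?B \<subseteq> (\<Union>z\<in>?P. ?D z)"
    then obtain S where S: "S \<subseteq> ?U" "card S = n ^ d" "\<not> well_spread d n C L (cell n N) S"
      and "S \<notin> (\<Union>z\<in>?P. ?D z)" by blast
    then have good: "\<bar>real (card (S \<inter> ?A z)) - ?mu z\<bar> \<le> C * sqrt (L * ?v z)" if "z \<in> ?P" for z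
    proof -
      have "S \<notin> ?D z" using that \<open>S \<notin> (\<Union>z\<in>?P. ?D z)\<close> by blast
      then show ?thesis using S(1,2) unfolding mem_Collect_eq not_less by argo
    qed
    have "well_spread d n C L (cell n N) S"
      unfolding well_spread_def
    proof (intro allI impI)
      fix a b v
      assume ab: "\<forall>i<d. 1 \<le> a i \<and> a i \<le> b i \<and> b i \<le> int n" and v: "L \<le> v"
        "(\<Prod>i<d. real_of_int (b i - a i + 2)) \<le> v"
      define z where "z = (map a [0..<d], map b [0..<d])"
      have z_nth: "fst z ! i = a i" "snd z ! i = b i" if "i < d" for i
        using that by (auto simp: z_def)
      have z: "z \<in> ?P" using ab by (force simp: z_def grid_def)
      have pr: "(\<Prod>i<d. real_of_int (snd z ! i - fst z ! i)) = (\<Prod>i<d. real_of_int (b i - a i))"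
        "(\<Prod>i<d. real_of_int (snd z ! i - fst z ! i + 2)) = (\<Prod>i<d. real_of_int (b i - a i + 2))"
        by (auto intro!: prod.cong simp: z_nth)
      have "C * sqrt (L * ?v z) \<le> C * sqrt (L * v)"
        unfolding pr using v L C by (intro mult_left_mono real_sqrt_le_mono) auto
      moreover have "S \<inter> ?A z = {x \<in> S. \<forall>i<d. a i \<le> cell n N x i \<and> cell n N x i \<le> b i}"
        using S(1) z_nth by auto
      ultimately show "real (card {x \<in> S. \<forall>i<d. a i \<le> cell n N x i \<and> cell n N x i \<le> b i})
        \<in> {(\<Prod>i<d. real_of_int (b i - a i)) - C * sqrt (L * v) ..
           (\<Prod>i<d. real_of_int (b i - a i + 2)) + C * sqrt (L * v)}"
        using good[OF z] muz[OF z] unfolding pr atLeastAtMost_iff by (simp only:) linarith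
    qed
    then show False using S by blast
  qed
  moreover have finD: "finite (?D z)" for z using U(1) by simp
  ultimately have "card ?B \<le> card (\<Union>z\<in>?P. ?D z)" using finP by (intro card_mono) auto
  also have "\<dots> \<le> (\<Sum>z\<in>?P. card (?D z))" by (rule card_UN_le[OF finP])
  finally have "real (card ?B) \<le> (\<Sum>z\<in>?P. real (card (?D z)))"
    by (simp only: of_nat_sum[symmetric] of_nat_le_iff)
  also have "\<dots> \<le> (\<Sum>z\<in>?P. 2 * exp (- (C - 1) * L) * real (N ^ d choose n ^ d))"
  proof (rule sum_mono)
    fix z assume z: "z \<in> ?P"
    have "?mu z \<le> ?v z" using muz[OF z] by auto
    then show "real (card (?D z)) \<le> 2 * exp (- (C - 1) * L) * real (N ^ d choose n ^ d)"
      using card_deviation_le[OF U, of "?A z" L "?v z" C] L by (auto simp: cU)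
  qed
  also have "\<dots> = real (card ?P) * (2 * exp (- (C - 1) * L) * real (N ^ d choose n ^ d))" by simp
  also have "\<dots> \<le> real (n ^ (2 * d)) * (2 * exp (- (C - 1) * L) * real (N ^ d choose n ^ d))"
  proof (intro mult_right_mono)
    have "card ?P \<le> card (?G \<times> ?G)" using finite_grid by (intro card_mono) auto
    also have "\<dots> = n ^ (2 * d)" by (simp add: card_grid card_cartesian_product mult_2 power_add)
    finally show "real (card ?P) \<le> real (n ^ (2 * d))" by linarith
  qed auto
  finally show ?thesis .
qed

text \<open>The drift condition amounts to \<open>s \<ge> 24 * d * L * step_error\<close>. The last
  summand in parentheses comes from the discrepancy, the others from rounding and from the spread of
  the cross-sections.\<close>

definition scale_const :: "nat \<Rightarrow> real \<Rightarrow> real" where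
  "scale_const d C = 24 * real d * (3 + 2 ^ d * (24 * real d) + 2 ^ d * C * sqrt (6 ^ d))"

text \<open>With \<open>T = L powr q\<close>, the assumptions on \<open>q\<close> enter through \<open>L \<le> T\<close> and \<open>L ^ 3 \<le> T ^ d\<close>.\<close>

lemma scale_admissible:
  fixes C L q s :: real
  assumes d: "2 \<le> d" and C: "0 \<le> C" and q: "1 \<le> q" "3 / real d < q" and L: "1 \<le> L"
  defines "s \<equiv> scale_const d C * L powr q"
  shows "L \<le> s" "18 \<le> s" "2 * step_error d C L s * (real d * L) \<le> s / 12"
proof -
  define T where "T = L powr q"
  define c1 where "c1 = 3 + 2 ^ d * (24 * real d)"
  define c2 where "c2 = 2 ^ d * C * sqrt (6 ^ d)"
  have c: "3 \<le> c1" "0 \<le> c2" using C by (auto simp: c1_def c2_def)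
  have s: "s = 24 * real d * (c1 + c2) * T" by (simp add: s_def scale_const_def T_def c1_def c2_def)
  have LT: "L \<le> T" using powr_mono[OF q(1) L] L by (simp add: T_def)
  then have T1: "1 \<le> T" using L by linarith
  have K: "18 \<le> 24 * real d * (c1 + c2)"
  proof -
    have "24 * 1 * 1 \<le> 24 * real d * (c1 + c2)"
      using d c by (intro mult_mono) auto
    then show ?thesis by simp
  qed
  have sT: "18 * T \<le> s" unfolding s using K T1 by (intro mult_right_mono) auto
  show "L \<le> s" "18 \<le> s" using sT T1 LT by linarith+
  have T3: "L ^ 3 \<le> T ^ d"
  proof -
    have "3 \<le> q * real d" using q(2) d by (simp add: field_simps)
    then have "L powr 3 \<le> L powr (q * real d)" using L by (intro powr_mono) auto
    also have "\<dots> = T ^ d" using L T1 by (simp add: T_def powr_powr[symmetric] powr_realpow)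
    finally show ?thesis using L by simp
  qed
  \<comment> \<open>After squaring and dropping \<open>6 ^ d\<close>, the claim is
    \<open>L ^ 3 * (1 / s) ^ (d - 2) \<le> T ^ 2\<close>, which follows from
    \<open>s \<ge> T\<close> and \<open>T3\<close>.\<close>
  have "sqrt (6 ^ d * L * (1 / s) ^ (d - 2)) * L \<le> sqrt (6 ^ d) * T"
  proof -
    have "(1 / s) ^ (d - 2) \<le> (1 / T) ^ (d - 2)"
      using sT T1 by (intro power_mono divide_left_mono) auto
    then have "L * (1 / s) ^ (d - 2) * L\<^sup>2 \<le> L * (1 / T) ^ (d - 2) * L\<^sup>2"
      using L by (intro mult_right_mono mult_left_mono) auto
    also have "\<dots> = L ^ 3 * (1 / T) ^ (d - 2)" by (simp add: power3_eq_cube power2_eq_square)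
    also have "\<dots> \<le> T ^ d * (1 / T) ^ (d - 2)" using T3 T1 by (intro mult_right_mono) auto
    also have "T ^ d = T\<^sup>2 * T ^ (d - 2)" using d by (metis le_add_diff_inverse power_add)
    also have "T\<^sup>2 * T ^ (d - 2) * (1 / T) ^ (d - 2) = T\<^sup>2" using T1 by (simp add: power_divide)
    finally have "6 ^ d * (L * (1 / s) ^ (d - 2) * L\<^sup>2) \<le> 6 ^ d * T\<^sup>2" by simp
    then have "sqrt (6 ^ d * L * (1 / s) ^ (d - 2) * L\<^sup>2) \<le> sqrt (6 ^ d * T\<^sup>2)"
      by (intro real_sqrt_le_mono) (simp add: mult_ac)
    then show ?thesis using L T1 by (simp add: real_sqrt_mult)
  qed
  then have "2 ^ d * C * (sqrt (6 ^ d * L * (1 / s) ^ (d - 2)) * L) \<le> 2 ^ d * C * (sqrt (6 ^ d) * T)"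
    using C by (intro mult_left_mono) auto
  moreover have "c1 * L \<le> c1 * T" using LT c by (intro mult_left_mono) auto
  ultimately have "step_error d C L s * L \<le> (c1 + c2) * T"
    by (simp add: step_error_def c1_def c2_def algebra_simps)
  then have "2 * real d * (step_error d C L s * L) \<le> 2 * real d * ((c1 + c2) * T)"
    by (intro mult_left_mono) auto
  then show "2 * step_error d C L s * (real d * L) \<le> s / 12" by (simp add: s algebra_simps)
qed

lemma F_scaled_le_of_well_spread:
  assumes d: "2 \<le> d" and C: "0 \<le> C" and q: "1 \<le> q" "3 / real d < q"
    and n: "2 \<le> n" "n \<le> N" and S: "S \<subseteq> grid d (int N)" "card S = n ^ d"
    and ws: "well_spread d n C (log 2 (real n)) (cell n N) S"
  shows "F d n S * log 2 (real n) powr (- q) \<le> real d * (2 + 6 * scale_const d C)"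
proof -
  define T where "T = log 2 (real n) powr q"
  have L: "1 \<le> log 2 (real n)" using n by (simp add: le_log_iff)
  have T: "1 \<le> T" unfolding T_def using L q by (intro ge_one_powr_ge_zero) auto
  note adm = scale_admissible[OF d C q L]
  have "F d n S \<le> real d * (2 + 6 * (scale_const d C * T))"
    unfolding T_def
    using L n by (intro F_le_of_well_spread[OF d _ n(2) S C ws _ adm(1,2,3)]) auto
  also have "\<dots> \<le> real d * ((2 + 6 * scale_const d C) * T)"
    using T by (intro mult_left_mono) (auto simp: algebra_simps)
  finally have "F d n S * (1 / T) \<le> real d * ((2 + 6 * scale_const d C) * T) * (1 / T)"
    using T by (intro mult_right_mono) auto
  then show ?thesis using T L by (simp add: powr_minus_divide T_def)
qed

text \<open>Since \<open>log 2 n \<ge> ln n\<close>, the constant \<open>2 * d + 3\<close> gives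
  each box a failure probability of at most \<open>2 / n ^ (2 * d + 2)\<close>. This outweighs the
  \<open>n ^ (2 * d)\<close> boxes and leaves a summable bound.\<close>

lemma measure_not_well_spread_le:
  fixes d n N :: nat
  assumes n: "2 \<le> n" "n \<le> N"
  defines "Fam \<equiv> {S. S \<subseteq> grid d (int N) \<and> card S = n ^ d}"
  shows "measure (uniform_count_measure Fam)
      {S \<in> Fam. \<not> well_spread d n (real (2 * d + 3)) (log 2 (real n)) (cell n N) S} \<le> 2 / real n ^ 2"
proof -
  let ?L = "log 2 (real n)"
  let ?C = "real (2 * d + 3)"
  let ?B = "{S \<in> Fam. \<not> well_spread d n ?C ?L (cell n N) S}"
  have L: "1 \<le> ?L" using n by (simp add: le_log_iff)
  have fin: "finite Fam" by (simp add: Fam_def finite_grid)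
  have card_Fam: "card Fam = N ^ d choose n ^ d"
    using n_subsets[OF finite_grid, of d "int N" "n ^ d"] by (simp add: Fam_def card_grid)
  have pos: "0 < card Fam" unfolding card_Fam using n by (simp add: power_mono)
  have "exp (- (?C - 1) * ?L) = exp (- (?L * real (2 * d + 2)))" by (simp add: algebra_simps)
  also have "\<dots> \<le> exp (- (ln 2 * ?L * real (2 * d + 2)))"
  proof -
    have "ln 2 * ?L \<le> 1 * ?L" using L ln_2_less_1 by (intro mult_right_mono) auto
    then show ?thesis using L by (intro exp_le_cancel_iff[THEN iffD2] le_imp_neg_le mult_right_mono) auto
  qed
  also have "ln 2 * ?L = ln (real n)" by (simp add: log_def)
  also have "exp (- (ln (real n) * real (2 * d + 2))) = 1 / real n ^ (2 * d + 2)"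
    by (simp only: exp_minus exp_of_nat2_mult) (use n in \<open>simp add: inverse_eq_divide\<close>)
  finally have e: "exp (- (?C - 1) * ?L) \<le> 1 / real n ^ (2 * d + 2)" .
  have "real (card ?B) \<le> real (n ^ (2 * d)) * (2 * exp (- (?C - 1) * ?L) * real (card Fam))"
    using card_not_well_spread_le[of n N ?L ?C d] n L
    unfolding card_Fam by (simp add: Fam_def conj_assoc)
  also have "\<dots> \<le> real (n ^ (2 * d)) * (2 * (1 / real n ^ (2 * d + 2)) * real (card Fam))"
    using e by (intro mult_left_mono mult_right_mono) auto
  also have "\<dots> = 2 / real n ^ 2 * real (card Fam)"
    using n by (simp add: power_add field_simps power2_eq_square)
  finally have "real (card ?B) / real (card Fam) \<le> 2 / real n ^ 2"
    using pos by (simp add: pos_divide_le_eq)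
  then show ?thesis using fin by (subst measure_uniform_count_measure) auto
qed

section \<open>Almost sure boundedness by the first Borel-Cantelli lemma\<close>

theorem theorem3:
  fixes d :: nat and c :: "nat \<Rightarrow> real" and q :: real
  assumes "d \<ge> 2"
    and "\<And>n. n \<ge> 2 \<Longrightarrow> c n \<ge> (1 + 2 ^ (d + 7) / log 2 (real n)) powr (1 / real d)"
    and "c 1 \<ge> 1"
    and "q \<ge> 1" and "q > 3 / real d"
  shows "measure (G d c)
           {\<omega> \<in> space (G d c).
              limsup (\<lambda>n. ereal (F d n (\<omega> n) * (log 2 (real n)) powr (- q))) < \<infinity>} = 1"
proof -
  define N where "N n = nat \<lfloor>c n * real n\<rfloor>" for n
  define M where "M n = uniform_count_measure (factor d c n)" for n
  define C where "C = real (2 * d + 3)"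
  \<comment> \<open>Proved for every \<open>n\<close>, because all factors must be nonempty for the
    product to be a probability space. At \<open>n = 1\<close> the assumption on \<open>c 1\<close>
    supplies the bound.\<close>
  have N: "int (N n) = \<lfloor>c n * real n\<rfloor>" "n \<le> N n" for n
  proof -
    have "int n \<le> \<lfloor>c n * real n\<rfloor>"
    proof (cases "n = 0")
      case False
      have "1 \<le> c n"
      proof (cases "n = 1")
        case True
        then show ?thesis using assms(3) by simp
      next
        case False
        then have "2 \<le> n" using \<open>n \<noteq> 0\<close> by linarith
        moreover have "1 \<le> (1 + 2 ^ (d + 7) / log 2 (real n)) powr (1 / real d)"
          using \<open>2 \<le> n\<close> by (intro ge_one_powr_ge_zero) auto
        ultimately show ?thesis using assms(2) by (meson order_trans)
      qed
      then have "1 * real n \<le> c n * real n" by (intro mult_right_mono) auto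
      then show ?thesis by (simp add: le_floor_iff)
    qed simp
    then show "int (N n) = \<lfloor>c n * real n\<rfloor>" "n \<le> N n" unfolding N_def by linarith+
  qed
  have factor: "factor d c n = {S. S \<subseteq> grid d (int (N n)) \<and> card S = n ^ d}" for n
    by (simp add: factor_def N)
  have fin: "finite (factor d c n)" for n by (simp add: factor finite_grid)
  have "card (factor d c n) = N n ^ d choose n ^ d" for n
    using n_subsets[OF finite_grid, of d "int (N n)" "n ^ d"] by (simp add: factor card_grid)
  then have "card (factor d c n) \<noteq> 0" for n using N(2)[of n] by (simp add: power_mono not_less)
  then have nonempty: "factor d c n \<noteq> {}" for n by (metis card.empty)
  have prob_M: "prob_space (M n)" for n
    unfolding M_def by (intro prob_space_uniform_count_measure fin nonempty)
  have G: "G d c = PiM UNIV M" unfolding G_def M_def ..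
  interpret G: prob_space "G d c" unfolding G by (intro prob_space_PiM prob_M)
  have comp: "(\<lambda>\<omega>. \<omega> n) \<in> measurable (G d c) (M n)" for n
    unfolding G by (rule measurable_component_singleton) simp
  have space_M: "space (M n) = factor d c n" and sets_M: "sets (M n) = Pow (factor d c n)" for n
    by (auto simp: M_def space_uniform_count_measure sets_uniform_count_measure)
  define B where "B n = {S \<in> factor d c n. \<not> well_spread d n C (log 2 (real n)) (cell n (N n)) S}" for n
  define E where "E n = (\<lambda>\<omega>. \<omega> n) -` B n \<inter> space (G d c)" for n
  have E_sets: "E n \<in> sets (G d c)" for n
    unfolding E_def by (rule measurable_sets[OF comp]) (auto simp: sets_M B_def)
  \<comment> \<open>The event concerns a single coordinate, whose distribution under the product
    measure is \<open>M n\<close>.\<close>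
  have E_measure: "measure (G d c) (E n) = measure (M n) (B n)" for n
  proof -
    have "measure (M n) (B n) = measure (distr (G d c) (M n) (\<lambda>\<omega>. \<omega> n)) (B n)"
      unfolding G by (subst distr_PiM_component) (auto intro: prob_M)
    also have "\<dots> = measure (G d c) (E n)"
      unfolding E_def by (rule measure_distr[OF comp]) (auto simp: sets_M B_def)
    finally show ?thesis by simp
  qed
  have "summable (\<lambda>n. measure (G d c) (E n))"
  proof (rule summable_comparison_test_ev)
    show "\<forall>\<^sub>F n in sequentially. norm (measure (G d c) (E n)) \<le> 2 * inverse (real n ^ 2)"
      using eventually_ge_at_top[of 2]
    proof eventually_elim
      case (elim n)
      then show ?case
        using measure_not_well_spread_le[OF elim N(2)[of n], of d]
        by (simp add: E_measure M_def B_def factor C_def divide_inverse)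
    qed
    show "summable (\<lambda>n. 2 * inverse (real n ^ 2))"
      by (intro summable_mult inverse_power_summable) simp
  qed
  then have "AE \<omega> in G d c. eventually (\<lambda>n. \<omega> \<in> space (G d c) - E n) sequentially"
    by (intro borel_cantelli_AE1 E_sets) (auto simp: G.emeasure_eq_measure)
  \<comment> \<open>Outside \<open>E n\<close> the scaled value of \<open>F\<close> is bounded by a
    constant depending only on \<open>d\<close>, so eventual avoidance of these events bounds the
    limit superior.\<close>
  moreover have "limsup (\<lambda>n. ereal (F d n (\<omega> n) * log 2 (real n) powr (- q))) < \<infinity>"
    if ev: "eventually (\<lambda>n. \<omega> \<in> space (G d c) - E n) sequentially" for \<omega>
  proof -
    have "\<forall>\<^sub>F n in sequentially. ereal (F d n (\<omega> n) * log 2 (real n) powr (- q))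
        \<le> ereal (real d * (2 + 6 * scale_const d C))"
      using ev eventually_ge_at_top[of 2]
    proof eventually_elim
      case (elim n)
      then have "\<omega> n \<in> factor d c n"
        using measurable_space[OF comp, of \<omega> n] by (simp add: space_M)
      moreover have "\<omega> n \<notin> B n" using elim by (auto simp: E_def)
      ultimately have "well_spread d n C (log 2 (real n)) (cell n (N n)) (\<omega> n)"
        "\<omega> n \<subseteq> grid d (int (N n))" "card (\<omega> n) = n ^ d"
        by (auto simp: B_def factor)
      then show ?case
        using F_scaled_le_of_well_spread[OF assms(1) _ assms(4,5) elim(2) N(2)] by (simp add: C_def)
    qed
    then have "limsup (\<lambda>n. ereal (F d n (\<omega> n) * log 2 (real n) powr (- q)))
        \<le> ereal (real d * (2 + 6 * scale_const d C))"
      by (rule Limsup_bounded)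
    then show ?thesis by (rule le_less_trans) simp
  qed
  ultimately have AE: "AE \<omega> in G d c. limsup (\<lambda>n. ereal (F d n (\<omega> n) * log 2 (real n) powr (- q))) < \<infinity>"
    by (auto elim: eventually_mono)
  \<comment> \<open>Measurability of the event allows passing from the almost-everywhere statement
    to probability one. Each \<open>M n\<close> carries the full power set, so every function of one
    coordinate is measurable.\<close>
  have meas: "(\<lambda>\<omega>. ereal (F d n (\<omega> n) * log 2 (real n) powr (- q))) \<in> borel_measurable (G d c)" for n
  proof (rule measurable_compose[OF comp])
    show "(\<lambda>S. ereal (F d n S * log 2 (real n) powr (- q))) \<in> borel_measurable (M n)"
      by (rule measurableI) (auto simp: space_M sets_M)
  qed
  have "(\<lambda>\<omega>. limsup (\<lambda>n. ereal (F d n (\<omega> n) * log 2 (real n) powr (- q)))) \<in> borel_measurable (G d c)"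
    by (rule borel_measurable_limsup[OF meas])
  then have "{\<omega> \<in> space (G d c). limsup (\<lambda>n. ereal (F d n (\<omega> n) * log 2 (real n) powr (- q))) < \<infinity>} \<in> sets (G d c)"
    by measurable
  then show ?thesis using AE by (subst G.prob_Collect_eq_1) auto
qed

end
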